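(* Let $M$ be a $d\times d$ dilation matrix, $m=|\det M|$, let $H$ be a symmetry group with respect to $M$, and let $n\in\mathbb N$. Then there exists an interpolatory mask $m_0$ that is $H$-symmetric with respect to the origin and has sum rule of order $n$. This mask can be represented by $$m_0(\xi)=\frac1m+\frac1{\sqrt m}\sum_{p=1}^{\#\Lambda-1}\nu_p(\xi),$$ where for each $p=1,\dots,\#\Lambda-1$ $$\nu_p(\xi)=\sum_{i=0}^{\#\Gamma_{\langle s_{p,0}\rangle}-1}\frac{e^{2\pi i(s_{p,i},\xi)}}{\#H_{\langle s_{p,0}\rangle}}\sum_{F\in H_{\langle s_{p,0}\rangle}}G_{0,p,0}\bigl(M^*F^*E^{(i)*}\xi\bigr)\,e^{2\pi i (r_{p,0}^F,\,M^*E^{(i)*}\xi)},$$ $E^{(i)}\in\Gamma_{\langle s_{p,0}\rangle}$ (in exponents the factor $i$ in $2\pi i$ is the imaginary unit), and $G_{0,p,0}$ are trigonometric polynomials such that $$D^\beta G_{0,p,0}(\mathbf 0)=\frac{(2\pi i)^{[\beta]}}{\sqrt m}\,(-M^{-1}s_{p,0})^\beta\qquad\forall \beta\in\Delta_n .$$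
   Context: Notation: $\mathbf 0$ is the zero vector of $\mathbb R^d$; for $\beta\in\mathbb Z_+^d$, $[\beta]=\sum_j\beta_j$, $a^\beta=\prod_j a_j^{\beta_j}$, $D^\beta$ is the partial derivative; $\Delta_n=\{\beta\in\mathbb Z^d_+:[\beta]<n\}$; $M^*$ is the (conjugate) transpose of $M$. A dilation matrix is an integer $d\times d$ matrix all of whose eigenvalues have modulus greater than $1$. A set of digits $D(M)$ is a set of representatives of the cosets of $\mathbb Z^d$ modulo $M\mathbb Z^d$, containing $\mathbf 0$; for $s\in\mathbb Z^d$, $\langle s\rangle=\{M\beta+s:\beta\in\mathbb Z^d\}$. $\mathcal D$ is the set of all $m$ cosets. A trigonometric polynomial is a finite sum $t(\xi)=\sum_{k\in\mathbb Z^d}h_ke^{2\pi i(k,\xi)}$, $h_k\in\mathbb C$. A (refinable) mask is a trigonometric polynomial $m_0$ with $m_0(\mathbf 0)=1$. $t$ is interpolatory if $\sum_{s\in D(M^* )}t(\xi+M^{*-1}s)\equiv1$. $t$ has sum rule of order $n$ if $D^\beta\bigl[t(M^{*-1}\xi)\bigr]\big|_{\xi=s}=0$ for all $s\in D(M^* )\setminus\{\mathbf 0\}$ and all $\beta\in\Delta_n$. A symmetry group on $\mathbb Z^d$ is a finite set $H$ of integer $d\times d$ matrices of determinant $\pm1$ forming a group under multiplication; it is a symmetry group with respect to $M$ if moreover $M^{-1}EM\in H$ for all $E\in H$. $t$ is $H$-symmetric with respect to the origin if $t(\xi)=t(E^*\xi)$ for all $E\in H$. Orbits and digits (with symmetry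 center $\mathbf 0$): $H$ acts on $\mathcal D$ by $E\langle s\rangle=\{EM\beta+Es:\beta\in\mathbb Z^d\}=\langle Es\rangle$. Let $\Lambda=\{\langle s_{p,0}\rangle:p=0,\dots,\#\Lambda-1\}\subset\mathcal D$ contain exactly one element of each orbit, with $s_{0,0}=\mathbf 0$. $H_{\langle s_{p,0}\rangle}$ is the stabilizer of $\langle s_{p,0}\rangle$ in $H$, and $\Gamma_{\langle s_{p,0}\rangle}=\{E^{(0)}=I_d,E^{(1)},\dots\}\subset H$ is a complete set of representatives of the left cosets $EH_{\langle s_{p,0}\rangle}$ (it depends on $p$; the index $p$ on $E^{(i)}$ is suppressed). The digits are chosen as $s_{p,i}:=E^{(i)}s_{p,0}$, $i=0,\dots,\#\Gamma_{\langle s_{p,0}\rangle}-1$, $p=0,\dots,\#\Lambda-1$; these form a set of digits of $M$. For $F\in H_{\langle s_{p,0}\rangle}$ the vector $r_{p,0}^F\in\mathbb Z^d$ is defined by $Fs_{p,0}=Mr_{p,0}^F+s_{p,0}$. *)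

theory Defs
  imports "HOL-Analysis.Analysis" "HOL-Algebra.Group_Action"
begin

abbreviation rvec :: "int ^ 'd \<Rightarrow> real ^ 'd" where
  "rvec k \<equiv> (\<chi> j. real_of_int (k $ j))"

abbreviation rmat :: "int ^ 'd ^ 'd \<Rightarrow> real ^ 'd ^ 'd" where
  "rmat A \<equiv> map_matrix real_of_int A"

definition mdeg :: "nat ^ 'd \<Rightarrow> nat" where
  "mdeg \<beta> = (\<Sum>j\<in>UNIV. \<beta> $ j)"

definition mpower :: "real ^ 'd \<Rightarrow> nat ^ 'd \<Rightarrow> real" where
  "mpower a \<beta> = (\<Prod>j\<in>UNIV. (a $ j) ^ (\<beta> $ j))"

definition Delta :: "nat \<Rightarrow> (nat ^ 'd) set" where
  "Delta n = {\<beta>. mdeg \<beta> < n}"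

definition partial :: "'d \<Rightarrow> (real ^ 'd \<Rightarrow> complex) \<Rightarrow> real ^ 'd \<Rightarrow> complex" where
  "partial j f = (\<lambda>x. vector_derivative (\<lambda>u. f (x + u *\<^sub>R axis j 1)) (at 0))"

(* The index type carries no order, so the order in which the partial derivatives are taken is
   fixed by an arbitrary enumeration of the coordinates. It is irrelevant for smooth functions,
   and the operator is only applied to trigonometric polynomials (composed with linear maps). *)
definition coord_enum :: "'d::finite list" where
  "coord_enum = (SOME js. distinct js \<and> set js = UNIV)"

definition mderiv :: "nat ^ 'd \<Rightarrow> (real ^ 'd \<Rightarrow> complex) \<Rightarrow> real ^ 'd \<Rightarrow> complex" where
  "mderiv \<beta> f = foldr (\<lambda>j g. (partial j ^^ (\<beta> $ j)) g) coord_enum f"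

definition dilation_matrix :: "int ^ 'd ^ 'd \<Rightarrow> bool" where
  "dilation_matrix M \<longleftrightarrow>
     (\<forall>(c::complex) v. v \<noteq> 0 \<and> map_matrix of_int M *v v = c *s v \<longrightarrow> cmod c > 1)"

definition lattice_coset :: "int ^ 'd ^ 'd \<Rightarrow> int ^ 'd \<Rightarrow> (int ^ 'd) set" where
  "lattice_coset M s = {M *v b + s | b. True}"

definition lattice_cosets :: "int ^ 'd ^ 'd \<Rightarrow> (int ^ 'd) set set" where
  "lattice_cosets M = range (lattice_coset M)"

definition digit_set :: "int ^ 'd ^ 'd \<Rightarrow> (int ^ 'd) set \<Rightarrow> bool" where
  "digit_set M D \<longleftrightarrow> 0 \<in> D \<and> (\<forall>C\<in>lattice_cosets M. \<exists>!s. s \<in> D \<and> lattice_coset M s = C)"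

definition expi :: "int ^ 'd \<Rightarrow> real ^ 'd \<Rightarrow> complex" where
  "expi k \<xi> = exp (2 * of_real pi * \<i> * of_real (rvec k \<bullet> \<xi>))"

definition trig_poly :: "(real ^ 'd \<Rightarrow> complex) \<Rightarrow> bool" where
  "trig_poly t \<longleftrightarrow> (\<exists>K h. finite K \<and> t = (\<lambda>\<xi>. \<Sum>k\<in>K. h k * expi k \<xi>))"

definition refinable_mask :: "(real ^ 'd \<Rightarrow> complex) \<Rightarrow> bool" where
  "refinable_mask t \<longleftrightarrow> trig_poly t \<and> t 0 = 1"

(* In the next two definitions D is a set of digits of the transpose of M. *)
definition interpolatory ::
    "int ^ 'd ^ 'd \<Rightarrow> (int ^ 'd) set \<Rightarrow> (real ^ 'd \<Rightarrow> complex) \<Rightarrow> bool" where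
  "interpolatory M D t \<longleftrightarrow>
     (\<forall>\<xi>. (\<Sum>s\<in>D. t (\<xi> + matrix_inv (transpose (rmat M)) *v rvec s)) = 1)"

definition sum_rule ::
    "int ^ 'd ^ 'd \<Rightarrow> (int ^ 'd) set \<Rightarrow> nat \<Rightarrow> (real ^ 'd \<Rightarrow> complex) \<Rightarrow> bool" where
  "sum_rule M D n t \<longleftrightarrow>
     (\<forall>s\<in>D - {0}. \<forall>\<beta>\<in>Delta n.
        mderiv \<beta> (\<lambda>\<xi>. t (matrix_inv (transpose (rmat M)) *v \<xi>)) (rvec s) = 0)"

definition mat_group :: "(int ^ 'd ^ 'd) set \<Rightarrow> (int ^ 'd ^ 'd) monoid" where
  "mat_group H = \<lparr>carrier = H, monoid.mult = (**), one = mat 1\<rparr>"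

definition symmetry_group :: "(int ^ 'd ^ 'd) set \<Rightarrow> bool" where
  "symmetry_group H \<longleftrightarrow> finite H \<and> (\<forall>E\<in>H. det E = 1 \<or> det E = -1) \<and> group (mat_group H)"

definition symmetry_group_wrt :: "int ^ 'd ^ 'd \<Rightarrow> (int ^ 'd ^ 'd) set \<Rightarrow> bool" where
  "symmetry_group_wrt M H \<longleftrightarrow> symmetry_group H \<and>
     (\<forall>E\<in>H. matrix_inv (rmat M) ** rmat E ** rmat M \<in> rmat ` H)"

definition symmetric_origin :: "(int ^ 'd ^ 'd) set \<Rightarrow> (real ^ 'd \<Rightarrow> complex) \<Rightarrow> bool" where
  "symmetric_origin H t \<longleftrightarrow> (\<forall>E\<in>H. \<forall>\<xi>. t \<xi> = t (transpose (rmat E) *v \<xi>))"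

definition coset_act :: "int ^ 'd ^ 'd \<Rightarrow> (int ^ 'd) set \<Rightarrow> (int ^ 'd) set" where
  "coset_act E C = (\<lambda>x. E *v x) ` C"

definition stab :: "(int ^ 'd ^ 'd) set \<Rightarrow> (int ^ 'd) set \<Rightarrow> (int ^ 'd ^ 'd) set" where
  "stab H C = stabilizer (mat_group H) coset_act C"

definition orbit_transversal ::
    "int ^ 'd ^ 'd \<Rightarrow> (int ^ 'd ^ 'd) set \<Rightarrow> (int ^ 'd) set set \<Rightarrow> bool" where
  "orbit_transversal M H \<Lambda> \<longleftrightarrow> \<Lambda> \<subseteq> lattice_cosets M \<and>
     (\<forall>O' \<in> orbits (mat_group H) (lattice_cosets M) coset_act. \<exists>!C. C \<in> \<Lambda> \<and> C \<in> O')"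

definition left_coset_reps ::
    "(int ^ 'd ^ 'd) set \<Rightarrow> (int ^ 'd ^ 'd) set \<Rightarrow> (int ^ 'd ^ 'd) set \<Rightarrow> bool" where
  "left_coset_reps H K \<Gamma> \<longleftrightarrow> \<Gamma> \<subseteq> H \<and>
     (\<forall>F\<in>H. \<exists>!E. E \<in> \<Gamma> \<and> E <#\<^bsub>mat_group H\<^esub> K = F <#\<^bsub>mat_group H\<^esub> K)"

(* The enumerations s of the orbit representatives, E p of the coset representatives of the
   stabilizer of the p-th of them, and the shift vectors r p F. The digits s_{p,i} are
   E p i *v s p. *)
definition symmetric_digit_data ::
    "int ^ 'd ^ 'd \<Rightarrow> (int ^ 'd ^ 'd) set \<Rightarrow> (int ^ 'd) set set \<Rightarrow> (nat \<Rightarrow> int ^ 'd) \<Rightarrow>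
     (nat \<Rightarrow> (int ^ 'd ^ 'd) set) \<Rightarrow> (nat \<Rightarrow> nat \<Rightarrow> int ^ 'd ^ 'd) \<Rightarrow>
     (nat \<Rightarrow> int ^ 'd ^ 'd \<Rightarrow> int ^ 'd) \<Rightarrow> bool" where
  "symmetric_digit_data M H \<Lambda> s \<Gamma> E r \<longleftrightarrow>
     orbit_transversal M H \<Lambda> \<and>
     bij_betw (\<lambda>p. lattice_coset M (s p)) {..<card \<Lambda>} \<Lambda> \<and> s 0 = 0 \<and>
     (\<forall>p<card \<Lambda>.
        left_coset_reps H (stab H (lattice_coset M (s p))) (\<Gamma> p) \<and>
        bij_betw (E p) {..<card (\<Gamma> p)} (\<Gamma> p) \<and> E p 0 = mat 1 \<and>
        (\<forall>F\<in>stab H (lattice_coset M (s p)). F *v s p = M *v r p F + s p))"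

definition nu ::
    "int ^ 'd ^ 'd \<Rightarrow> (int ^ 'd ^ 'd) set \<Rightarrow> (nat \<Rightarrow> int ^ 'd) \<Rightarrow> (nat \<Rightarrow> (int ^ 'd ^ 'd) set) \<Rightarrow>
     (nat \<Rightarrow> nat \<Rightarrow> int ^ 'd ^ 'd) \<Rightarrow> (nat \<Rightarrow> int ^ 'd ^ 'd \<Rightarrow> int ^ 'd) \<Rightarrow>
     (nat \<Rightarrow> real ^ 'd \<Rightarrow> complex) \<Rightarrow> nat \<Rightarrow> real ^ 'd \<Rightarrow> complex" where
  "nu M H s \<Gamma> E r G p \<xi> =
     (\<Sum>i<card (\<Gamma> p).
        expi (E p i *v s p) \<xi> / of_nat (card (stab H (lattice_coset M (s p)))) *
        (\<Sum>F\<in>stab H (lattice_coset M (s p)).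
           G p ((transpose (rmat M) ** transpose (rmat F) ** transpose (rmat (E p i))) *v \<xi>) *
           expi (r p F) ((transpose (rmat M) ** transpose (rmat (E p i))) *v \<xi>)))"

end

theory Submission
  imports Defs
begin

text \<open>
  Substituting \<^term>\<open>F *v s p = M *v r p F + s p\<close> into the formula for \<open>\<nu>\<^sub>p\<close> and using that
  \<open>(i, F) \<mapsto> E\<^sup>i F\<close> is a bijection onto \<open>H\<close>, one gets that \<open>\<nu>\<^sub>p\<close> is an average over \<open>A \<in> H\<close> of exponentials with
  frequencies \<open>A (M k + s\<^sub>p)\<close>, weighted by the Fourier coefficients of \<open>G\<^sub>p\<close>. So the mask is
  \<open>H\<close>-symmetric, and it is interpolatory because for \<open>p \<ge> 1\<close> no such frequency lies in the lattice
  \<open>M \<int>\<^sup>d\<close>. Tensor products of Lagrange weights on \<open>{0,\<dots>,n-1}\<^sup>d\<close> give a \<open>G\<^sub>p\<close> with the prescribed jet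
  at the origin; then in every derivative of order less than \<open>n\<close> at a digit \<open>t\<close> of \<open>M\<^sup>*\<close> only the
  sum of the character \<open>x \<mapsto> exp (2 \<pi> \<i> (M\<^sup>-\<^sup>1 x, t))\<close> over \<open>\<int>\<^sup>d / M \<int>\<^sup>d\<close> survives, which is zero for
  \<open>t \<noteq> 0\<close>. The normalisation \<open>m\<^sub>0(0) = 1\<close> rests on \<open>|\<int>\<^sup>d / M \<int>\<^sup>d| = |det M|\<close>, proved by comparing
  the volumes of two fundamental domains of \<open>M \<int>\<^sup>d\<close>.
\<close>

subsection \<open>The index of an integer lattice\<close>

text \<open>
  The library's \<open>measure_linear_image\<close> asks for a well-ordered index type, which is not available
  here.
\<close>

definition scales_volume :: "real^'n^'n \<Rightarrow> bool" where
  "scales_volume A \<longleftrightarrow> (\<forall>S\<in>lmeasurable. (*v) A ` S \<in> lmeasurable \<and>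
     measure lebesgue ((*v) A ` S) = \<bar>det A\<bar> * measure lebesgue S)"

lemma scales_volume_mult:
  assumes "scales_volume A" "scales_volume B"
  shows "scales_volume (A ** B)"
proof -
  have "(*v) (A ** B) ` S = (*v) A ` (*v) B ` S" for S
    by (auto simp: image_image matrix_vector_mul_assoc)
  then show ?thesis
    using assms by (simp add: scales_volume_def det_mul abs_mult)
qed

lemma scales_volume_singular:
  fixes A :: "real^'n^'n"
  assumes "det A = 0"
  shows "scales_volume A"
proof -
  have "\<not> inj ((*v) A)"
    using assms det_nz_iff_inj[OF matrix_vector_mul_linear, of A] by simp
  then have "negligible ((*v) A ` S)" for S
    by (intro negligible_linear_singular_image matrix_vector_mul_linear)
  then show ?thesis
    unfolding scales_volume_def
    by (metis assms abs_zero mult_zero_left negligible_imp_measure0 negligible_imp_measurable)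
qed

lemma scales_volume_diagonal:
  fixes A :: "real^'n^'n"
  assumes "\<And>i j. i \<noteq> j \<Longrightarrow> A$i$j = 0"
  shows "scales_volume A"
proof -
  have "(\<Sum>j\<in>UNIV. A $ i $ j * x $ j) = (\<Sum>j\<in>UNIV. if j = i then A $ i $ i * x $ i else 0)"
    for i and x :: "real^'n"
    using assms by (intro sum.cong) auto
  then have "(*v) A = (\<lambda>x. \<chi> i. A$i$i * x$i)"
    by (simp add: matrix_vector_mult_def fun_eq_iff vec_eq_iff)
  then show ?thesis
    by (simp add: scales_volume_def measurable_stretch measure_stretch det_diagonal assms)
qed

lemma scales_volumeI:
  fixes A :: "real^'n^'n"
  assumes "\<bar>det A\<bar> = 1"
    and "\<And>a b. cbox a b \<noteq> {} \<Longrightarrow> measure lebesgue ((*v) A ` cbox a b) = measure lebesgue (cbox a b)"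
  shows "scales_volume A"
proof -
  have "measure lebesgue ((*v) A ` cbox a b) = 1 * measure lebesgue (cbox a b)" for a b
    using assms(2) by (cases "cbox a b = {}") auto
  note * = measure_linear_sufficient[OF matrix_vector_mul_linear _ this]
  show ?thesis
    unfolding scales_volume_def assms(1) using * by (metis)
qed

lemma scales_volume_swap:
  fixes m n :: "'n::finite"
  assumes "m \<noteq> n"
  shows "scales_volume (\<chi> i j. mat 1 $ i $ Transposition.transpose m n j :: real^'n^'n)" (is "scales_volume ?A")
proof (rule scales_volumeI)
  show "\<bar>det ?A\<bar> = 1"
    by (simp add: det_permute_columns permutes_swap_id sign_swap_id abs_mult)
next
  fix a b :: "real^'n"
  assume ne: "cbox a b \<noteq> {}"
  let ?t = "Transposition.transpose m n"
  let ?h = "\<lambda>v::real^'n. \<chi> i. v $ ?t i"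
  have tt: "?t i = j \<longleftrightarrow> i = ?t j" for i j
    by (metis transpose_involutory)
  have "?A *v x = ?h x" for x
    by (simp add: vec_eq_iff matrix_vector_mult_def mat_def if_distrib[of "\<lambda>c. c * _"] tt[symmetric] cong: if_cong)
  then have h: "(*v) ?A = ?h" by auto
  have "?h ` cbox a b = cbox (?h a) (?h b)"
  proof (intro equalityI subsetI)
    fix x assume x: "x \<in> cbox (?h a) (?h b)"
    have "?h x \<in> cbox a b"
      using x by (auto simp: mem_box_cart) (metis transpose_involutory)+
    moreover have "x = ?h (?h x)" by (simp add: vec_eq_iff)
    ultimately show "x \<in> ?h ` cbox a b" by blast
  qed (auto simp: mem_box_cart)
  moreover have "(\<Prod>i\<in>UNIV. b $ ?t i - a $ ?t i) = (\<Prod>i\<in>UNIV. b $ i - a $ i)"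
    by (rule prod.reindex_bij_betw) simp
  moreover have "cbox (?h a) (?h b) \<noteq> {}"
    using ne calculation(1) by blast
  ultimately show "measure lebesgue ((*v) ?A ` cbox a b) = measure lebesgue (cbox a b)"
    using ne by (simp add: h content_cbox_cart)
qed

lemma scales_volume_shear:
  fixes m n :: "'n::finite"
  assumes mn: "m \<noteq> n"
  shows "scales_volume (\<chi> i j. of_bool (i = m \<and> j = n \<or> i = j) :: real^'n^'n)" (is "scales_volume ?A")
proof (rule scales_volumeI)
  have "?A = (\<chi> k. if k = m then row m (mat 1) + 1 *s row n (mat 1) else row k (mat 1))"
    using mn by (auto simp: vec_eq_iff row_def mat_def)
  then show "\<bar>det ?A\<bar> = 1"
    by (simp only: det_row_operation[OF mn] det_I abs_one)
next
  fix a b :: "real^'n"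
  assume ne: "cbox a b \<noteq> {}"
  let ?h = "\<lambda>x::real^'n. \<chi> i. if i = m then x$m + x$n else x$i"
  have "(\<Sum>j\<in>UNIV. of_bool (i = m \<and> j = n \<or> i = j) * x $ j) = (if i = m then x$m + x$n else x$i)"
    for i and x :: "real^'n"
  proof -
    have "(\<Sum>j\<in>UNIV. of_bool (i = m \<and> j = n \<or> i = j) * x $ j)
        = (\<Sum>j\<in>UNIV. (if j = n then if i = m then x $ n else 0 else 0) + (if j = i then x $ i else 0))"
      using mn by (intro sum.cong) auto
    then show ?thesis by (simp add: sum.distrib)
  qed
  then have h: "(*v) ?A = ?h"
    by (simp add: fun_eq_iff vec_eq_iff matrix_vector_mult_def)
  define v where "v = axis n (a $ n)"
  have ab: "cbox a b = (+) v ` cbox (a - v) (b - v)"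
    using cbox_translation[of v "a - v" "b - v"] by simp
  have "(*v) ?A ` cbox a b = (+) (?A *v v) ` ((*v) ?A ` cbox (a - v) (b - v))"
    unfolding ab by (simp add: image_comp o_def matrix_vector_right_distrib)
  then have "measure lebesgue ((*v) ?A ` cbox a b) = measure lebesgue ((*v) ?A ` cbox (a - v) (b - v))"
    by (simp only: measure_translation)
  also have "\<dots> = measure lebesgue (cbox (a - v) (b - v))"
    unfolding h using ne ab by (intro measure_shear_interval[OF mn]) (auto simp: v_def)
  also have "\<dots> = measure lebesgue (cbox a b)"
    unfolding ab by (simp only: measure_translation)
  finally show "measure lebesgue ((*v) ?A ` cbox a b) = measure lebesgue (cbox a b)" .
qed

lemma scales_volume: "scales_volume A"
proof (rule induct_matrix_elementary_alt)
  show "scales_volume A" if "row i A = 0" for A :: "real^'a^'a" and i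
    by (rule scales_volume_singular[OF det_zero_row(1)[OF that]])
qed (fact scales_volume_mult scales_volume_diagonal scales_volume_swap scales_volume_shear)+

lemma emeasure_linear_image:
  fixes A :: "real^'n^'n"
  assumes "S \<in> lmeasurable"
  shows "emeasure lebesgue ((*v) A ` S) = ennreal \<bar>det A\<bar> * emeasure lebesgue S"
proof -
  have "(*v) A ` S \<in> lmeasurable" "measure lebesgue ((*v) A ` S) = \<bar>det A\<bar> * measure lebesgue S"
    using scales_volume[of A] assms by (simp_all add: scales_volume_def)
  then show ?thesis
    using assms by (simp add: emeasure_eq_measure2 ennreal_mult')
qed

lemma rvec_add: "rvec (x + y) = rvec x + rvec y"
  and rvec_uminus: "rvec (- x) = - rvec x"
  and rvec_zero: "rvec 0 = 0"
  and rvec_eq_iff: "rvec x = rvec y \<longleftrightarrow> x = y"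
  and rvec_axis: "rvec (axis j 1) = axis j 1"
  by (simp_all add: vec_eq_iff axis_def)

lemma rvec_mult: "rvec (A *v x) = rmat A *v rvec x"
  by (simp add: vec_eq_iff matrix_vector_mult_def)

lemma rmat_mult: "rmat (A ** B) = rmat A ** rmat B"
  by (simp add: vec_eq_iff matrix_matrix_mult_def)

lemma rmat_transpose: "rmat (transpose A) = transpose (rmat A)"
  by (simp add: vec_eq_iff transpose_def)

lemma det_rmat: "det (rmat A) = real_of_int (det A)"
  by (simp add: det_def)

lemma rmat_eq_iff: "rmat A = rmat B \<longleftrightarrow> A = B"
  by (simp add: vec_eq_iff)

lemma invertible_rmat: "det M \<noteq> 0 \<Longrightarrow> invertible (rmat M)"
  by (simp add: invertible_det_nz det_rmat)

lemma matrix_inv_cancel: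
  fixes A :: "real^'n^'n"
  assumes "invertible A"
  shows "matrix_inv A *v (A *v x) = x" "A *v (matrix_inv A *v x) = x"
proof -
  have "A ** matrix_inv A = mat 1 \<and> matrix_inv A ** A = mat 1"
    using assms unfolding invertible_def matrix_inv_def by (rule someI_ex)
  then show "matrix_inv A *v (A *v x) = x" "A *v (matrix_inv A *v x) = x"
    by (simp_all add: matrix_vector_mul_assoc)
qed

lemma int_matrix_inj:
  fixes M :: "int^'n^'n"
  assumes "det M \<noteq> 0" "M *v x = M *v y"
  shows "x = y"
  by (metis assms invertible_rmat matrix_inv_cancel(1) rvec_eq_iff rvec_mult)

definition unit_cube :: "(real^'n) set" where
  "unit_cube = {x. \<forall>j. 0 \<le> x $ j \<and> x $ j < 1}"

lemma unit_cube_sets: "unit_cube \<in> sets lebesgue"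
proof -
  have "unit_cube = {x::real^'n. \<forall>j\<in>UNIV. 0 \<le> x $ j \<and> x $ j < 1}"
    by (simp add: unit_cube_def)
  also have "\<dots> \<in> sets lborel" by simp
  finally show ?thesis by (rule sets_completionI_sets)
qed

lemma emeasure_unit_cube: "emeasure lebesgue (unit_cube :: (real^'n) set) = 1"
proof (rule antisym)
  have c1: "measure lborel (cbox 0 1 :: (real^'n) set) = 1"
    by (subst content_cbox_cart) (auto simp: interval_ne_empty_cart)
  have "emeasure lebesgue (unit_cube :: (real^'n) set) \<le> emeasure lebesgue (cbox 0 1 :: (real^'n) set)"
    by (rule emeasure_mono) (auto simp: unit_cube_def mem_box_cart less_imp_le)
  also have "\<dots> = 1"
    using c1 by (simp add: emeasure_eq_ennreal_measure[symmetric] emeasure_eq_measure2)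
  finally show "emeasure lebesgue (unit_cube :: (real^'n) set) \<le> 1" .
  have "1 = emeasure lebesgue (box 0 1 :: (real^'n) set)"
    using c1 by (simp add: measure_lborel_box_eq measure_lborel_cbox_eq emeasure_eq_measure2)
  also have "\<dots> \<le> emeasure lebesgue (unit_cube :: (real^'n) set)"
    using unit_cube_sets by (intro emeasure_mono) (auto simp: unit_cube_def mem_box_cart less_imp_le)
  finally show "1 \<le> emeasure lebesgue (unit_cube :: (real^'n) set)" .
qed

lemma unit_cube_iff: "x - rvec k \<in> unit_cube \<longleftrightarrow> k = (\<chi> j. \<lfloor>x $ j\<rfloor>)"
proof -
  have "0 \<le> a - real_of_int i \<and> a - real_of_int i < 1 \<longleftrightarrow> i = \<lfloor>a\<rfloor>" for a i
    by linarith
  then show ?thesis by (simp add: unit_cube_def vec_eq_iff)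
qed

lemma emeasure_lebesgue_translation:
  fixes a :: "'a::euclidean_space"
  shows "emeasure lebesgue ((+) a ` S) = emeasure lebesgue S"
  using emeasure_lebesgue_affine[of 1 a S] by (simp add: add.commute)

lemma fundamental_domains_emeasure_eq:
  fixes v :: "'i::{countable,group_add} \<Rightarrow> 'a::euclidean_space"
  assumes sets: "A \<in> sets lebesgue" "B \<in> sets lebesgue"
    and A: "\<And>x. \<exists>!b. x - v b \<in> A" and B: "\<And>x. \<exists>!b. x - v b \<in> B"
    and v: "\<And>b. v (- b) = - v b"
  shows "emeasure lebesgue A = emeasure lebesgue B"
proof -
  have mem: "x \<in> (+) w ` S \<longleftrightarrow> x - w \<in> S" for x w :: 'a and S
    by (auto simp: image_iff) (metis add.commute diff_add_cancel)
  have split: "emeasure lebesgue C = (\<integral>\<^sup>+b. emeasure lebesgue (C \<inter> (+) (v b) ` D) \<partial>count_space UNIV)"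
    if C: "C \<in> sets lebesgue" and D: "D \<in> sets lebesgue" "\<And>x. \<exists>!b. x - v b \<in> D" for C D
  proof -
    have C_eq: "C = (\<Union>b. C \<inter> (+) (v b) ` D)"
      using ex1_implies_ex[OF D(2)] by (fastforce simp only: mem UN_iff Int_iff)
    have "disjoint_family (\<lambda>b. C \<inter> (+) (v b) ` D)"
      unfolding disjoint_family_on_def
    proof (intro ballI impI equals0I)
      fix b b' x
      assume "b \<noteq> b'" "x \<in> C \<inter> (+) (v b) ` D \<inter> (C \<inter> (+) (v b') ` D)"
      then show False using D(2)[of x] by (simp only: Int_iff mem) blast
    qed
    then have "emeasure lebesgue (\<Union>b. C \<inter> (+) (v b) ` D)
        = (\<integral>\<^sup>+b. emeasure lebesgue (C \<inter> (+) (v b) ` D) \<partial>count_space UNIV)"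
      by (intro emeasure_UN_countable sets.Int C lebesgue_sets_translation D(1)) auto
    then show ?thesis using C_eq by (simp only: flip: C_eq)
  qed
  have "emeasure lebesgue A = (\<integral>\<^sup>+b. emeasure lebesgue (A \<inter> (+) (v b) ` B) \<partial>count_space UNIV)"
    by (rule split[OF sets B])
  also have "\<dots> = (\<integral>\<^sup>+b. emeasure lebesgue (B \<inter> (+) (v (- b)) ` A) \<partial>count_space UNIV)"
  proof (intro nn_integral_cong)
    fix b
    have "(+) (v b) ` (B \<inter> (+) (v (- b)) ` A) = A \<inter> (+) (v b) ` B"
      by (auto simp: set_eq_iff mem v)
    then show "emeasure lebesgue (A \<inter> (+) (v b) ` B) = emeasure lebesgue (B \<inter> (+) (v (- b)) ` A)"
      using emeasure_lebesgue_translation by metis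
  qed
  also have "\<dots> = (\<integral>\<^sup>+b. emeasure lebesgue (B \<inter> (+) (v b) ` A) \<partial>count_space UNIV)"
    by (rule nn_integral_bij_count_space[where f = "\<lambda>b. emeasure lebesgue (B \<inter> (+) (v b) ` A)"])
       (metis bij_uminus)
  also have "\<dots> = emeasure lebesgue B"
    by (rule split[OF sets(2,1) A, symmetric])
  finally show ?thesis .
qed

lemma mem_lattice_coset: "x \<in> lattice_coset M s \<longleftrightarrow> (\<exists>b. x = M *v b + s)"
  by (auto simp: lattice_coset_def)

lemma lattice_coset_eq_iff: "lattice_coset M x = lattice_coset M s \<longleftrightarrow> x \<in> lattice_coset M s"
proof
  assume "lattice_coset M x = lattice_coset M s"
  moreover have "x \<in> lattice_coset M x"
    unfolding mem_lattice_coset by (rule exI[of _ 0]) simp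
  ultimately show "x \<in> lattice_coset M s" by simp
next
  assume "x \<in> lattice_coset M s"
  then obtain b where b: "x = M *v b + s" by (auto simp: mem_lattice_coset)
  have "M *v c + x = M *v (c + b) + s" "M *v c + s = M *v (c - b) + x" for c
    by (simp_all add: b matrix_vector_right_distrib matrix_vector_mult_diff_distrib)
  then show "lattice_coset M x = lattice_coset M s"
    unfolding set_eq_iff mem_lattice_coset by metis
qed

lemma mem_lattice_coset_self: "x \<in> lattice_coset M x"
  by (simp flip: lattice_coset_eq_iff)

lemma card_lattice_cosets:
  fixes M :: "int^'n^'n"
  assumes "det M \<noteq> 0"
  shows "finite (lattice_cosets M)" "card (lattice_cosets M) = nat \<bar>det M\<bar>"
proof -
  define R where "R = (\<lambda>C. SOME x. x \<in> C) ` lattice_cosets M"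
  have some: "lattice_coset M (SOME x. x \<in> C) = C" if C: "C \<in> lattice_cosets M" for C
  proof -
    obtain s where s: "C = lattice_coset M s" using C unfolding lattice_cosets_def by blast
    then have "(SOME x. x \<in> C) \<in> C" by (metis mem_lattice_coset_self someI)
    then show ?thesis by (simp add: s lattice_coset_eq_iff)
  qed
  then have bij: "bij_betw (\<lambda>C. SOME x. x \<in> C) (lattice_cosets M) R"
    unfolding R_def by (intro inj_on_imp_bij_betw inj_onI) metis
  have R: "\<exists>!c. c \<in> R \<and> (\<exists>b. k = M *v b + c)" for k
  proof -
    have "(\<exists>b. k = M *v b + c) \<longleftrightarrow> lattice_coset M c = lattice_coset M k" for c
      by (metis lattice_coset_eq_iff mem_lattice_coset)
    moreover have "\<exists>!c. c \<in> R \<and> lattice_coset M c = lattice_coset M k"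
      using some by (auto simp: R_def lattice_cosets_def)
    ultimately show ?thesis by simp
  qed
  let ?v = "\<lambda>b::int^'n. rmat M *v rvec b"
  define A where "A = (*v) (rmat M) ` unit_cube"
  define B where "B = (\<Union>c\<in>R. (+) (rvec c) ` unit_cube)"
  have cube: "(unit_cube :: (real^'n) set) \<in> lmeasurable"
    by (rule fmeasurableI) (simp_all add: unit_cube_sets emeasure_unit_cube)
  have mem: "x \<in> (+) w ` S \<longleftrightarrow> x - w \<in> S" for x w :: "real^'n" and S
    by (auto simp: image_iff) (metis add.commute diff_add_cancel)
  have B_iff: "x - ?v b \<in> B \<longleftrightarrow> (\<exists>c\<in>R. M *v b + c = (\<chi> j. \<lfloor>x $ j\<rfloor>))" for x b
  proof -
    have "x - ?v b - rvec c = x - rvec (M *v b + c)" for c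
      by (simp only: rvec_add rvec_mult diff_diff_eq)
    then show ?thesis by (simp only: B_def UN_iff mem unit_cube_iff)
  qed
  have "emeasure lebesgue A = emeasure lebesgue B"
  proof (rule fundamental_domains_emeasure_eq[where v = ?v])
    show "A \<in> sets lebesgue"
      using scales_volume[of "rmat M"] cube by (simp add: A_def scales_volume_def fmeasurableD)
    show "B \<in> sets lebesgue"
      unfolding B_def by (intro sets.countable_UN'') (auto intro: lebesgue_sets_translation unit_cube_sets)
    show "\<exists>!b. x - ?v b \<in> A" for x
    proof -
      have "x - ?v b \<in> A \<longleftrightarrow> matrix_inv (rmat M) *v x - rvec b \<in> unit_cube" for b
        unfolding A_def image_iff
        by (metis (no_types) assms invertible_rmat matrix_inv_cancel matrix_vector_mult_diff_distrib)
      then show ?thesis by (simp add: unit_cube_iff)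
    qed
    show "\<exists>!b. x - ?v b \<in> B" for x
      unfolding B_iff using R[of "\<chi> j. \<lfloor>x $ j\<rfloor>"] int_matrix_inj[OF assms] by (metis add_right_cancel)
    show "?v (- b) = - ?v b" for b
      by (simp only: rvec_uminus) (simp add: vec.neg)
  qed
  also have "emeasure lebesgue B = (\<integral>\<^sup>+c. emeasure lebesgue ((+) (rvec c) ` unit_cube) \<partial>count_space R)"
    unfolding B_def
  proof (rule emeasure_UN_countable)
    show "disjoint_family_on (\<lambda>c. (+) (rvec c) ` (unit_cube :: (real^'n) set)) R"
      unfolding disjoint_family_on_def
    proof (intro ballI impI equals0I)
      fix c c' and x :: "real^'n"
      assume "c \<noteq> c'" "x \<in> (+) (rvec c) ` unit_cube \<inter> (+) (rvec c') ` unit_cube"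
      then show False by (simp only: Int_iff mem unit_cube_iff)
    qed
  qed (auto intro: lebesgue_sets_translation unit_cube_sets)
  also have "\<dots> = emeasure (count_space R) R"
    by (simp add: emeasure_lebesgue_translation emeasure_unit_cube)
  finally have eq: "emeasure (count_space R) R = ennreal \<bar>real_of_int (det M)\<bar>"
    by (simp add: A_def emeasure_linear_image[OF cube] emeasure_unit_cube det_rmat)
  have fin: "finite R"
  proof (rule ccontr)
    assume "infinite R"
    then show False using eq by (simp add: emeasure_count_space_infinite)
  qed
  show "finite (lattice_cosets M)"
    using bij_betw_finite[OF bij] fin by simp
  have "ennreal (real (card R)) = ennreal \<bar>real_of_int (det M)\<bar>"
    using eq fin by (simp add: ennreal_of_nat_eq_real_of_nat)
  then have "real (card R) = \<bar>real_of_int (det M)\<bar>" by simp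
  then show "card (lattice_cosets M) = nat \<bar>det M\<bar>"
    using bij_betw_same_card[OF bij] by linarith
qed

subsection \<open>Exponential sums and their derivatives\<close>

definition rexpi :: "real^'n \<Rightarrow> real^'n \<Rightarrow> complex" where
  "rexpi x \<xi> = exp (2 * of_real pi * \<i> * of_real (x \<bullet> \<xi>))"

lemma expi_eq_rexpi: "expi k = rexpi (rvec k)"
  by (simp add: expi_def rexpi_def fun_eq_iff)

lemma rexpi_add: "rexpi (x + y) \<xi> = rexpi x \<xi> * rexpi y \<xi>"
  and rexpi_add_right: "rexpi x (\<xi> + \<eta>) = rexpi x \<xi> * rexpi x \<eta>"
  and rexpi_zero: "rexpi 0 \<xi> = 1"
  and rexpi_zero_right: "rexpi x 0 = 1"
  by (simp_all add: rexpi_def inner_add_left inner_add_right distrib_left exp_add)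

lemma rexpi_mult_vec: "rexpi (A *v x) \<xi> = rexpi x (transpose A *v \<xi>)"
  by (metis dot_lmul_matrix inner_commute rexpi_def transpose_matrix_vector)

lemma rexpi_eq_1_iff: "rexpi x \<xi> = 1 \<longleftrightarrow> x \<bullet> \<xi> \<in> \<int>"
proof -
  have "rexpi x \<xi> = 1 \<longleftrightarrow> (\<exists>n::int. x \<bullet> \<xi> = of_int n)"
    by (simp add: rexpi_def exp_eq_1 mult.commute)
  then show ?thesis by (auto simp: Ints_def)
qed

lemma inner_rvec_in_Ints: "rvec k \<bullet> rvec l \<in> \<int>"
  by (simp add: inner_vec_def Ints_sum Ints_mult)

lemma partial_exp_sum:
  "partial j (\<lambda>\<xi>. \<Sum>k\<in>K. c k * rexpi (x k) \<xi>)
    = (\<lambda>\<xi>. \<Sum>k\<in>K. c k * (2 * of_real pi * \<i> * of_real (x k $ j)) * rexpi (x k) \<xi>)"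
proof
  fix \<xi>
  have "((\<lambda>u. \<Sum>k\<in>K. c k * rexpi (x k) (\<xi> + u *\<^sub>R axis j 1)) has_vector_derivative
      (\<Sum>k\<in>K. c k * (2 * of_real pi * \<i> * of_real (x k $ j)) * rexpi (x k) \<xi>)) (at 0)"
  proof (rule has_vector_derivative_sum)
    fix k
    define w where "w = 2 * complex_of_real pi * \<i>"
    have "((\<lambda>z. c k * exp (w * (of_real (x k \<bullet> \<xi>) + z * of_real (x k $ j)))) has_field_derivative
      c k * (exp (w * of_real (x k \<bullet> \<xi>)) * (w * of_real (x k $ j)))) (at (of_real 0))"
      by (auto intro!: derivative_eq_intros)
    from has_vector_derivative_real_field[OF this]
    have "((\<lambda>u. c k * exp (w * of_real (x k \<bullet> \<xi> + u * x k $ j))) has_vector_derivative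
      c k * (exp (w * of_real (x k \<bullet> \<xi>)) * (w * of_real (x k $ j)))) (at 0)"
      by simp
    then show "((\<lambda>u. c k * rexpi (x k) (\<xi> + u *\<^sub>R axis j 1)) has_vector_derivative
      c k * (2 * of_real pi * \<i> * of_real (x k $ j)) * rexpi (x k) \<xi>) (at 0)"
      unfolding rexpi_def w_def inner_add_right inner_scaleR_right inner_axis
      by (simp only: inner_real_def mult_1_left mult_1_right mult_ac)
  qed
  then show "partial j (\<lambda>\<xi>. \<Sum>k\<in>K. c k * rexpi (x k) \<xi>) \<xi>
      = (\<Sum>k\<in>K. c k * (2 * of_real pi * \<i> * of_real (x k $ j)) * rexpi (x k) \<xi>)"
    unfolding partial_def by (rule vector_derivative_at)
qed

lemma partial_funpow_exp_sum:
  "(partial j ^^ l) (\<lambda>\<xi>. \<Sum>k\<in>K. c k * rexpi (x k) \<xi>)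
    = (\<lambda>\<xi>. \<Sum>k\<in>K. c k * (2 * of_real pi * \<i> * of_real (x k $ j)) ^ l * rexpi (x k) \<xi>)"
proof (induction l)
  case (Suc l)
  show ?case
    unfolding funpow.simps o_apply Suc.IH partial_exp_sum by (simp only: power_Suc mult_ac)
qed simp

lemma coord_enum: "distinct (coord_enum :: 'n::finite list)" "set (coord_enum :: 'n list) = UNIV"
proof -
  have "\<exists>js :: 'n list. distinct js \<and> set js = UNIV"
    using finite_distinct_list[OF finite_class.finite_UNIV] by metis
  from someI_ex[OF this] show "distinct (coord_enum :: 'n list)" "set (coord_enum :: 'n list) = UNIV"
    unfolding coord_enum_def by auto
qed

lemma mderiv_exp_sum:
  fixes x :: "'k \<Rightarrow> real^'n"
  shows "mderiv \<beta> (\<lambda>\<xi>. \<Sum>k\<in>K. c k * rexpi (x k) \<xi>) \<xi>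
    = (2 * of_real pi * \<i>) ^ mdeg \<beta> * (\<Sum>k\<in>K. c k * of_real (mpower (x k) \<beta>) * rexpi (x k) \<xi>)"
proof -
  let ?w = "2 * complex_of_real pi * \<i>"
  have "distinct js \<Longrightarrow> foldr (\<lambda>j g. (partial j ^^ (\<beta> $ j)) g) js (\<lambda>\<xi>. \<Sum>k\<in>K. c k * rexpi (x k) \<xi>)
      = (\<lambda>\<xi>. \<Sum>k\<in>K. (c k * (\<Prod>j\<in>set js. (?w * of_real (x k $ j)) ^ (\<beta> $ j))) * rexpi (x k) \<xi>)" for js
  proof (induction js)
    case (Cons j js)
    then have "foldr (\<lambda>j g. (partial j ^^ (\<beta> $ j)) g) (j # js) (\<lambda>\<xi>. \<Sum>k\<in>K. c k * rexpi (x k) \<xi>)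
      = (partial j ^^ (\<beta> $ j)) (\<lambda>\<xi>. \<Sum>k\<in>K. (c k * (\<Prod>j\<in>set js. (?w * of_real (x k $ j)) ^ (\<beta> $ j))) * rexpi (x k) \<xi>)"
      by (simp only: foldr.simps o_apply distinct.simps simp_thms)
    then show ?case
      using Cons.prems unfolding partial_funpow_exp_sum
      by (simp only: list.set distinct.simps prod.insert[OF finite_set] simp_thms mult_ac)
  qed simp
  from this[OF coord_enum(1)] have "mderiv \<beta> (\<lambda>\<xi>. \<Sum>k\<in>K. c k * rexpi (x k) \<xi>) \<xi>
    = (\<Sum>k\<in>K. (c k * (\<Prod>j\<in>UNIV. (?w * of_real (x k $ j)) ^ (\<beta> $ j))) * rexpi (x k) \<xi>)"
    by (simp add: mderiv_def coord_enum(2))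
  moreover have "(\<Prod>j\<in>UNIV. (?w * of_real (x k $ j)) ^ (\<beta> $ j)) = ?w ^ mdeg \<beta> * of_real (mpower (x k) \<beta>)" for k
    by (simp only: power_mult_distrib prod.distrib power_sum mdeg_def mpower_def of_real_prod of_real_power)
  ultimately show ?thesis
    by (simp only: sum_distrib_left mult_ac)
qed

subsection \<open>Characters of the quotient group\<close>

lemma character_lattice_coset_cong:
  assumes z: "\<And>b. z \<bullet> rvec (N *v b) \<in> \<int>" and xy: "x \<in> lattice_coset N y"
  shows "rexpi z (rvec x) = rexpi z (rvec y)"
proof -
  obtain b where "x = N *v b + y" using xy unfolding mem_lattice_coset by blast
  moreover have "rexpi z (rvec (N *v b)) = 1" using z by (simp only: rexpi_eq_1_iff)
  ultimately show ?thesis by (simp only: rvec_add rexpi_add_right mult_1_left)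
qed

lemma sum_character_lattice_cosets:
  fixes N :: "int^'n^'n"
  assumes z: "\<And>b. z \<bullet> rvec (N *v b) \<in> \<int>" and "z \<notin> range rvec"
    and rep: "\<And>C. C \<in> lattice_cosets N \<Longrightarrow> rep C \<in> C"
  shows "(\<Sum>C\<in>lattice_cosets N. rexpi z (rvec (rep C))) = 0"
proof -
  have "\<exists>j. z $ j \<notin> \<int>"
  proof (rule ccontr)
    assume "\<nexists>j. z $ j \<notin> \<int>"
    then have "z = rvec (\<chi> j. \<lfloor>z $ j\<rfloor>)" by (simp add: vec_eq_iff)
    with \<open>z \<notin> range rvec\<close> show False by blast
  qed
  then obtain j where j: "z $ j \<notin> \<int>" by blast
  let ?e = "axis j 1 :: int^'n"
  have ne1: "rexpi z (rvec ?e) \<noteq> 1"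
    unfolding rvec_axis rexpi_eq_1_iff using j by (simp add: inner_axis)
  note cong = character_lattice_coset_cong[OF z]
  define T where "T u C = (\<lambda>x. x + u) ` C" for u and C :: "(int^'n) set"
  have T: "T u (lattice_coset N s) = lattice_coset N (s + u)" for u s
    by (auto simp: T_def lattice_coset_def image_def add.assoc)
  have bij: "bij_betw (T ?e) (lattice_cosets N) (lattice_cosets N)"
    by (rule bij_betwI[where g = "T (- ?e)"]) (auto simp: lattice_cosets_def T)
  have shift: "rexpi z (rvec (rep (T ?e C))) = rexpi z (rvec ?e) * rexpi z (rvec (rep C))"
    if C: "C \<in> lattice_cosets N" for C
  proof -
    obtain s where s: "C = lattice_coset N s" using C unfolding lattice_cosets_def by blast
    have "rep C \<in> lattice_coset N s" using rep[OF C] s by simp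
    note 1 = cong[OF this]
    have "rep (T ?e C) \<in> lattice_coset N (s + ?e)"
      using rep[of "T ?e C"] by (simp add: s T lattice_cosets_def)
    note 2 = cong[OF this]
    show ?thesis unfolding 1 2 by (simp only: rvec_add rexpi_add_right mult.commute)
  qed
  let ?S = "\<Sum>C\<in>lattice_cosets N. rexpi z (rvec (rep C))"
  have "?S = (\<Sum>C\<in>lattice_cosets N. rexpi z (rvec (rep (T ?e C))))"
    by (rule sum.reindex_bij_betw[OF bij, symmetric])
  also have "\<dots> = rexpi z (rvec ?e) * ?S"
    using shift by (simp add: sum_distrib_left)
  finally have "(1 - rexpi z (rvec ?e)) * ?S = 0" by (simp only: left_diff_distrib) simp
  then show ?thesis using ne1 by (simp only: mult_eq_0_iff right_minus_eq) metis
qed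

lemma digit_set_bij_betw:
  assumes "digit_set N D"
  shows "bij_betw (lattice_coset N) D (lattice_cosets N)"
  using assms unfolding digit_set_def bij_betw_def inj_on_def lattice_cosets_def
  by (auto simp: image_iff) metis+

lemma sum_character_digit_set:
  fixes N :: "int^'n^'n"
  assumes D: "digit_set N D" and z: "\<And>b. z \<bullet> rvec (N *v b) \<in> \<int>"
  shows "(\<Sum>t\<in>D. rexpi z (rvec t)) = (if z \<in> range rvec then of_nat (card (lattice_cosets N)) else 0)"
proof (cases "z \<in> range rvec")
  case True
  then obtain k where k: "z = rvec k" by blast
  have "rexpi z (rvec t) = 1" for t
    by (simp only: rexpi_eq_1_iff k inner_rvec_in_Ints)
  then show ?thesis
    using True bij_betw_same_card[OF digit_set_bij_betw[OF D]] by simp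
next
  case False
  let ?rep = "inv_into D (lattice_coset N)"
  note bij = digit_set_bij_betw[OF D]
  have rep: "?rep C \<in> C" if "C \<in> lattice_cosets N" for C
    using bij_betw_inv_into_right[OF bij that] mem_lattice_coset_self by metis
  have "(\<Sum>t\<in>D. rexpi z (rvec t)) = (\<Sum>C\<in>lattice_cosets N. rexpi z (rvec (?rep C)))"
    by (rule sum.reindex_bij_betw[OF bij_betw_inv_into[OF bij], symmetric])
  also have "\<dots> = 0"
    by (rule sum_character_lattice_cosets[OF z False rep])
  finally show ?thesis using False by simp
qed

subsection \<open>Weights with prescribed moments\<close>

lemma lagrange_weights:
  fixes a :: real
  shows "\<exists>w. \<forall>l<n. (\<Sum>k<n. w k * real k ^ l) = a ^ l"
proof -
  define L :: "nat \<Rightarrow> real poly" where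
    "L k = (\<Prod>j\<in>{..<n} - {k}. smult (1 / (real k - real j)) [:- real j, 1:])" for k
  have deg: "degree (L k) < n" if "k < n" for k
  proof -
    have "degree (L k) \<le> (\<Sum>j\<in>{..<n} - {k}. 1)"
      unfolding L_def by (intro order.trans[OF degree_prod_sum_le] sum_mono) auto
    then show ?thesis using that by simp
  qed
  have L: "poly (L k) (real i) = of_bool (i = k)" if "k < n" "i < n" for i k
  proof (cases "i = k")
    case True
    then show ?thesis by (auto simp: L_def poly_prod simp flip: diff_divide_distrib intro!: prod.neutral)
  next
    case False
    then show ?thesis using that by (auto simp: L_def poly_prod intro!: prod_zero bexI[of _ i])
  qed
  have "(\<Sum>k<n. poly (L k) a * real k ^ l) = a ^ l" if "l < n" for l
  proof -
    have "monom 1 l = (\<Sum>k<n. smult (real k ^ l) (L k))"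
    proof (rule poly_eqI_degree[where A = "real ` {..<n}"])
      show "poly (monom 1 l) x = poly (\<Sum>k<n. smult (real k ^ l) (L k)) x" if x: "x \<in> real ` {..<n}" for x
      proof -
        obtain i where i: "x = real i" "i < n" using x by auto
        have "(\<Sum>k<n. real k ^ l * poly (L k) x) = (\<Sum>k<n. if k = i then real i ^ l else 0)"
          using i by (intro sum.cong) (auto simp: L)
        then show ?thesis using i by (simp add: poly_monom poly_sum)
      qed
      have card: "card (real ` {..<n}) = n" by (simp add: card_image)
      show "degree (monom (1::real) l) < card (real ` {..<n})"
        using that by (simp add: card degree_monom_eq)
      have "degree (\<Sum>k<n. smult (real k ^ l) (L k)) < n"
        using that deg by (intro degree_sum_less) (auto intro: le_less_trans[OF degree_smult_le])
      then show "degree (\<Sum>k<n. smult (real k ^ l) (L k)) < card (real ` {..<n})"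
        by (simp only: card)
    qed
    then have "poly (monom 1 l) a = poly (\<Sum>k<n. smult (real k ^ l) (L k)) a"
      by (rule arg_cong)
    then show ?thesis by (simp only: poly_monom poly_sum poly_smult mult.commute mult_1_right)
  qed
  then show ?thesis by (intro exI[of _ "\<lambda>k. poly (L k) a"]) simp
qed

lemma moment_weights:
  fixes a :: "real^'n"
  shows "\<exists>K h. finite K \<and> (\<forall>\<beta>\<in>Delta n. (\<Sum>k\<in>K. h k * mpower (rvec k) \<beta>) = mpower a \<beta>) \<and>
    (a = 0 \<longrightarrow> K = {0} \<and> h 0 = (1::real))"
proof (cases "a = 0")
  case True
  then show ?thesis
    by (intro exI[of _ "{0}"] exI[of _ "\<lambda>_. 1"]) (simp add: rvec_zero mpower_def)
next
  case False
  have "\<forall>j. \<exists>w. \<forall>l<n. (\<Sum>k<n. w k * real k ^ l) = (a $ j) ^ l"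
    using lagrange_weights by blast
  from choice[OF this]
  obtain w where w: "\<And>j l. l < n \<Longrightarrow> (\<Sum>k<n. w j k * real k ^ l) = (a $ j) ^ l"
    by blast
  let ?P = "Pi\<^sub>E (UNIV :: 'n set) (\<lambda>_. {..<n})"
  let ?v = "\<lambda>g::'n \<Rightarrow> nat. (\<chi> j. int (g j))"
  have inj: "inj_on ?v ?P" by (auto simp: inj_on_def vec_eq_iff)
  define h where "h k = (\<Prod>j\<in>UNIV. w j (nat (k $ j)))" for k :: "int^'n"
  have "(\<Sum>k\<in>?v ` ?P. h k * mpower (rvec k) \<beta>) = mpower a \<beta>" if "\<beta> \<in> Delta n" for \<beta>
  proof -
    have less: "\<beta> $ j < n" for j
    proof -
      have "\<beta> $ j \<le> mdeg \<beta>" unfolding mdeg_def by (rule member_le_sum) auto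
      then show ?thesis using that by (simp add: Delta_def)
    qed
    have "(\<Sum>k\<in>?v ` ?P. h k * mpower (rvec k) \<beta>) = (\<Sum>g\<in>?P. \<Prod>j\<in>UNIV. w j (g j) * real (g j) ^ (\<beta> $ j))"
      by (simp add: sum.reindex[OF inj] h_def mpower_def prod.distrib)
    also have "\<dots> = (\<Prod>j\<in>UNIV. \<Sum>k<n. w j k * real k ^ (\<beta> $ j))"
      by (rule prod_sum_PiE[symmetric]) auto
    also have "\<dots> = mpower a \<beta>"
      by (simp add: w[OF less] mpower_def)
    finally show ?thesis .
  qed
  moreover have "finite (?v ` ?P)" by (intro finite_imageI finite_PiE) auto
  ultimately show ?thesis using False by blast
qed

lemma mpower_add_axis: "mpower x (\<beta> + axis j 1) = x $ j * mpower x \<beta>"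
proof -
  have "mpower x (\<beta> + axis j 1) = (\<Prod>i\<in>UNIV. x $ i ^ (\<beta> $ i) * (if i = j then x $ j else 1))"
    unfolding mpower_def by (intro prod.cong) (auto simp: axis_def)
  then show ?thesis by (simp add: prod.distrib mpower_def)
qed

lemma mdeg_add_axis: "mdeg (\<beta> + axis j 1) = Suc (mdeg \<beta>)"
  by (simp add: mdeg_def sum.distrib axis_def)

lemma moments_affine_product:
  fixes x :: "'k \<Rightarrow> real^'n"
  assumes moments: "\<And>\<beta>. \<beta> \<in> Delta n \<Longrightarrow> (\<Sum>k\<in>K. h k * mpower (x k) \<beta>) = mpower a \<beta>"
    and "finite I" "card I + mdeg \<beta> < n"
  shows "(\<Sum>k\<in>K. h k * (\<Prod>i\<in>I. b i + w i \<bullet> x k) * mpower (x k) \<beta>)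
    = (\<Prod>i\<in>I. b i + w i \<bullet> a) * mpower a \<beta>"
  using assms(2,3)
proof (induction I arbitrary: \<beta> rule: finite_induct)
  case empty
  then show ?case using moments by (simp add: Delta_def)
next
  case (insert i I)
  let ?p = "\<lambda>y. \<Prod>i\<in>I. b i + w i \<bullet> y"
  let ?S = "\<lambda>\<beta>. \<Sum>k\<in>K. h k * ?p (x k) * mpower (x k) \<beta>"
  have expand: "(b i + w i \<bullet> y) * c * mpower y \<beta> = b i * (c * mpower y \<beta>)
      + (\<Sum>j\<in>UNIV. w i $ j * (c * mpower y (\<beta> + axis j 1)))" for y c
    by (simp add: mpower_add_axis inner_vec_def algebra_simps sum_distrib_left del: One_nat_def)
  have "(\<Sum>k\<in>K. h k * (\<Prod>i\<in>insert i I. b i + w i \<bullet> x k) * mpower (x k) \<beta>)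
      = (\<Sum>k\<in>K. (b i + w i \<bullet> x k) * (h k * ?p (x k)) * mpower (x k) \<beta>)"
    using insert.hyps by (simp add: mult_ac)
  also have "\<dots> = b i * ?S \<beta> + (\<Sum>j\<in>UNIV. w i $ j * ?S (\<beta> + axis j 1))"
    unfolding expand sum.distrib sum_distrib_left
    by (subst sum.swap[of _ UNIV]) (simp add: mult_ac)
  also have "\<dots> = b i * (?p a * mpower a \<beta>) + (\<Sum>j\<in>UNIV. w i $ j * (?p a * mpower a (\<beta> + axis j 1)))"
  proof -
    have "?S \<beta> = ?p a * mpower a \<beta>"
      using insert by (intro insert.IH) simp
    moreover have "?S (\<beta> + axis j 1) = ?p a * mpower a (\<beta> + axis j 1)" for j
      using insert by (intro insert.IH) (simp add: mdeg_add_axis del: One_nat_def)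
    ultimately show ?thesis by (simp only:)
  qed
  also have "\<dots> = (\<Prod>i\<in>insert i I. b i + w i \<bullet> a) * mpower a \<beta>"
    using insert.hyps by (simp flip: expand del: One_nat_def)
  finally show ?case .
qed

lemma moments_linear_image:
  fixes x :: "'k \<Rightarrow> real^'n" and A :: "real^'n^'n"
  assumes moments: "\<And>\<beta>. \<beta> \<in> Delta n \<Longrightarrow> (\<Sum>k\<in>K. h k * mpower (x k) \<beta>) = mpower a \<beta>"
    and \<beta>: "\<beta> \<in> Delta n"
  shows "(\<Sum>k\<in>K. h k * mpower (A *v (x k - a)) \<beta>) = of_bool (\<beta> = 0)"
proof -
  let ?I = "SIGMA j:UNIV. {..<\<beta> $ j}"
  let ?b = "\<lambda>(j, l::nat). - (A *v a) $ j" and ?w = "\<lambda>(j, l::nat). A $ j"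
  have prod: "(\<Prod>i\<in>?I. ?b i + ?w i \<bullet> y) = mpower (A *v (y - a)) \<beta>" for y
  proof -
    have "(\<Prod>i\<in>?I. ?b i + ?w i \<bullet> y) = (\<Prod>(j, l)\<in>?I. (A *v (y - a)) $ j)"
      by (intro prod.cong)
         (auto simp: matrix_vector_mult_diff_distrib matrix_vector_mul_component)
    also have "\<dots> = mpower (A *v (y - a)) \<beta>"
      by (subst prod.Sigma[symmetric]) (auto simp: mpower_def)
    finally show ?thesis .
  qed
  have m0: "mpower y 0 = 1" for y :: "real^'n" by (simp add: mpower_def)
  have "(\<Sum>k\<in>K. h k * (\<Prod>i\<in>?I. ?b i + ?w i \<bullet> x k) * mpower (x k) 0) = (\<Prod>i\<in>?I. ?b i + ?w i \<bullet> a) * mpower a 0"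
  proof (rule moments_affine_product[OF moments])
    show "card ?I + mdeg 0 < n"
      using \<beta> by (simp add: Delta_def mdeg_def)
  qed auto
  moreover have "mpower (0::real^'n) \<beta> = of_bool (\<beta> = 0)"
    by (auto simp: mpower_def vec_eq_iff)
  ultimately show ?thesis unfolding prod m0 by simp
qed

lemma trig_poly_sum:
  assumes "finite I"
  shows "trig_poly (\<lambda>\<xi>. \<Sum>i\<in>I. c i * expi (f i) \<xi>)"
proof -
  have "(\<Sum>i\<in>I. c i * expi (f i) \<xi>) = (\<Sum>k\<in>f ` I. (\<Sum>i\<in>{i\<in>I. f i = k}. c i) * expi k \<xi>)" for \<xi>
    unfolding sum.image_gen[OF assms, of "\<lambda>i. c i * expi (f i) \<xi>" f] sum_distrib_right
    by (intro sum.cong) auto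
  then show ?thesis
    unfolding trig_poly_def using assms
    by (intro exI[of _ "f ` I"] exI[of _ "\<lambda>k. \<Sum>i\<in>{i\<in>I. f i = k}. c i"]) auto
qed

subsection \<open>Orbits of the symmetry group\<close>

lemma dilation_matrix_det_nonzero:
  fixes M :: "int^'n^'n"
  assumes "dilation_matrix M"
  shows "det M \<noteq> 0"
proof
  assume "det M = 0"
  let ?C = "map_matrix complex_of_int M"
  have "det ?C = of_int (det M)" by (simp add: det_def)
  with \<open>det M = 0\<close> have "\<not> invertible ?C" by (simp add: invertible_det_nz)
  then obtain v where "v \<noteq> 0" "?C *v v = 0"
    by (metis invertible_left_inverse matrix_left_invertible_ker)
  then show False
    using assms unfolding dilation_matrix_def by (metis norm_zero not_one_less_zero vector_smult_lzero)
qed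

locale symmetric_digits =
  fixes M :: "int^'n^'n" and H :: "(int^'n^'n) set" and \<Lambda> :: "(int^'n) set set"
    and s :: "nat \<Rightarrow> int^'n" and \<Gamma> :: "nat \<Rightarrow> (int^'n^'n) set"
    and E :: "nat \<Rightarrow> nat \<Rightarrow> int^'n^'n" and r :: "nat \<Rightarrow> int^'n^'n \<Rightarrow> int^'n"
  assumes det_nonzero: "det M \<noteq> 0"
    and sym: "symmetry_group_wrt M H"
    and data: "symmetric_digit_data M H \<Lambda> s \<Gamma> E r"
begin

abbreviation coset :: "int^'n \<Rightarrow> (int^'n) set" where
  "coset \<equiv> lattice_coset M"

abbreviation K :: "nat \<Rightarrow> (int^'n^'n) set" where
  "K p \<equiv> stab H (coset (s p))"

lemma finite_H: "finite H"
  using sym by (simp add: symmetry_group_wrt_def symmetry_group_def)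

lemma group_H: "group (mat_group H)"
  using sym by (simp add: symmetry_group_wrt_def symmetry_group_def)

lemma H_mult: "A \<in> H \<Longrightarrow> B \<in> H \<Longrightarrow> A ** B \<in> H"
  using monoid.m_closed[OF group.is_monoid[OF group_H]] by (simp add: mat_group_def)

lemma H_one: "mat 1 \<in> H"
  using monoid.one_closed[OF group.is_monoid[OF group_H]] by (simp add: mat_group_def)

lemma H_inverse:
  assumes "A \<in> H"
  obtains B where "B \<in> H" "B ** A = mat 1" "A ** B = mat 1"
  using group.l_inv_ex[OF group_H, of A] group.r_inv_ex[OF group_H, of A]
    group.l_inv[OF group_H, of A] group.r_inv[OF group_H, of A] group.inv_closed[OF group_H, of A] assms
  by (metis mat_group_def monoid.simps(1,2) partial_object.simps(1))

lemma H_conjugate: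
  assumes "A \<in> H"
  obtains A' where "A' \<in> H" "A ** M = M ** A'"
proof -
  obtain A' where A': "A' \<in> H" "matrix_inv (rmat M) ** rmat A ** rmat M = rmat A'"
    using sym assms unfolding symmetry_group_wrt_def by blast
  have "rmat M *v (rmat A' *v x) = rmat A *v (rmat M *v x)" for x
    by (simp add: matrix_vector_mul_assoc[symmetric] matrix_inv_cancel(2)[OF invertible_rmat[OF det_nonzero]] flip: A'(2))
  then have "rmat M ** rmat A' = rmat A ** rmat M"
    by (simp add: matrix_eq matrix_vector_mul_assoc[symmetric])
  then have "A ** M = M ** A'" by (metis rmat_mult rmat_eq_iff)
  then show thesis using A'(1) that by blast
qed

lemma coset_act_coset:
  assumes "A \<in> H"
  shows "coset_act A (coset x) = coset (A *v x)"
proof -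
  obtain A' where A': "A' \<in> H" "A ** M = M ** A'" using H_conjugate[OF assms] .
  obtain B where B: "A' ** B = mat 1" using H_inverse[OF A'(1)] .
  have eq: "A *v (M *v b + x) = M *v (A' *v b) + A *v x" for b
    using A'(2) by (simp add: matrix_vector_right_distrib matrix_vector_mul_assoc)
  have surj: "A' *v (B *v b) = b" for b
    using B by (simp add: matrix_vector_mul_assoc)
  show ?thesis
  proof (intro equalityI subsetI)
    fix y assume "y \<in> coset_act A (coset x)"
    then show "y \<in> coset (A *v x)"
      unfolding coset_act_def mem_lattice_coset lattice_coset_def using eq by blast
  next
    fix y assume "y \<in> coset (A *v x)"
    then obtain b where "y = M *v b + A *v x" unfolding mem_lattice_coset by blast
    then have "y = A *v (M *v (B *v b) + x)" by (simp add: eq surj)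
    then show "y \<in> coset_act A (coset x)"
      unfolding coset_act_def lattice_coset_def by blast
  qed
qed

lemma coset_cong: "A \<in> H \<Longrightarrow> coset x = coset y \<Longrightarrow> coset (A *v x) = coset (A *v y)"
  by (simp flip: coset_act_coset)

lemma mem_stab: "F \<in> stab H (coset x) \<longleftrightarrow> F \<in> H \<and> coset (F *v x) = coset x"
  by (simp add: stab_def stabilizer_def mat_group_def coset_act_coset cong: conj_cong)

lemma stab_mult: "F \<in> stab H (coset x) \<Longrightarrow> F' \<in> stab H (coset x) \<Longrightarrow> F ** F' \<in> stab H (coset x)"
  using coset_cong[of F "F' *v x" x] by (simp add: mem_stab H_mult flip: matrix_vector_mul_assoc)

lemma stab_inverse:
  assumes "F \<in> stab H (coset x)" "B \<in> H" "B ** F = mat 1"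
  shows "B \<in> stab H (coset x)"
proof -
  have "coset (B *v (F *v x)) = coset (B *v x)"
    using assms by (intro coset_cong) (simp_all add: mem_stab)
  moreover have "B *v (F *v x) = x" by (simp add: matrix_vector_mul_assoc assms(3))
  ultimately have "coset (B *v x) = coset x" by simp
  then show ?thesis unfolding mem_stab using assms(2) by blast
qed

lemma l_coset_mult_stab:
  assumes "A \<in> H" and F: "F \<in> stab H (coset x)"
  shows "(A ** F) <#\<^bsub>mat_group H\<^esub> stab H (coset x) = A <#\<^bsub>mat_group H\<^esub> stab H (coset x)"
proof -
  obtain B where B: "B \<in> H" "B ** F = mat 1" "F ** B = mat 1"
    using F H_inverse[of F] by (metis mem_stab)
  have "A ** k = A ** F ** (B ** k)" for k
    using B(3) by (metis matrix_mul_assoc matrix_mul_lid)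
  moreover have "A ** F ** k = A ** (F ** k)" for k by (simp add: matrix_mul_assoc)
  moreover have "F ** k \<in> stab H (coset x)" "B ** k \<in> stab H (coset x)" if "k \<in> stab H (coset x)" for k
    using that F stab_inverse[OF F B(1,2)] by (simp_all add: stab_mult)
  ultimately show ?thesis
    unfolding l_coset_def mat_group_def monoid.simps by blast
qed

lemma left_coset_reps_bij_betw:
  assumes "left_coset_reps H (stab H (coset x)) G"
  shows "bij_betw (\<lambda>(A, F). A ** F) (G \<times> stab H (coset x)) H"
proof (rule bij_betw_imageI)
  have GH: "G \<subseteq> H" and ex: "\<And>F. F \<in> H \<Longrightarrow> \<exists>!A. A \<in> G \<and>
      A <#\<^bsub>mat_group H\<^esub> stab H (coset x) = F <#\<^bsub>mat_group H\<^esub> stab H (coset x)"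
    using assms by (auto simp: left_coset_reps_def)
  have one: "mat 1 \<in> stab H (coset x)" by (simp add: mem_stab H_one)
  show "inj_on (\<lambda>(A, F). A ** F) (G \<times> stab H (coset x))"
  proof (rule inj_onI, clarify)
    fix A F A' F'
    assume A: "A \<in> G" "A' \<in> G" and F: "F \<in> stab H (coset x)" "F' \<in> stab H (coset x)"
      and eq: "A ** F = A' ** F'"
    have AH: "A \<in> H" "A' \<in> H" using A GH by blast+
    have "A' <#\<^bsub>mat_group H\<^esub> stab H (coset x) = A <#\<^bsub>mat_group H\<^esub> stab H (coset x)"
      using l_coset_mult_stab[OF AH(1) F(1)] l_coset_mult_stab[OF AH(2) F(2)] eq by simp
    then have "A = A'" using ex[OF AH(1)] A by blast
    obtain B where B: "B ** A = mat 1" using H_inverse[OF subsetD[OF GH A(1)]] .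
    have "F = B ** (A ** F)" by (simp add: matrix_mul_assoc B)
    also have "A ** F = A ** F'" using eq \<open>A = A'\<close> by simp
    also have "B ** (A ** F') = F'" by (simp add: matrix_mul_assoc B)
    finally have "F = F'" .
    with \<open>A = A'\<close> show "A = A' \<and> F = F'" by simp
  qed
  show "(\<lambda>(A, F). A ** F) ` (G \<times> stab H (coset x)) = H"
  proof (intro equalityI subsetI)
    fix B assume "B \<in> (\<lambda>(A, F). A ** F) ` (G \<times> stab H (coset x))"
    then show "B \<in> H" using GH H_mult by (auto simp: mem_stab)
  next
    fix B assume B: "B \<in> H"
    then obtain A where A: "A \<in> G"
      "A <#\<^bsub>mat_group H\<^esub> stab H (coset x) = B <#\<^bsub>mat_group H\<^esub> stab H (coset x)"
      using ex by blast
    have "B \<in> B <#\<^bsub>mat_group H\<^esub> stab H (coset x)"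
      unfolding l_coset_def mat_group_def monoid.simps using one by (intro UN_I[of "mat 1"]) simp_all
    then have "B \<in> A <#\<^bsub>mat_group H\<^esub> stab H (coset x)" using A(2) by simp
    then obtain F where "F \<in> stab H (coset x)" "B = A ** F"
      unfolding l_coset_def mat_group_def monoid.simps by blast
    then show "B \<in> (\<lambda>(A, F). A ** F) ` (G \<times> stab H (coset x))" using A(1) by force
  qed
qed

lemma s_zero: "s 0 = 0"
  and bij_\<Lambda>: "bij_betw (\<lambda>p. coset (s p)) {..<card \<Lambda>} \<Lambda>"
  and \<Lambda>_subset: "\<Lambda> \<subseteq> lattice_cosets M"
  using data by (simp_all add: symmetric_digit_data_def orbit_transversal_def)

lemma
  assumes "p < card \<Lambda>"
  shows left_coset_reps_\<Gamma>: "left_coset_reps H (K p) (\<Gamma> p)"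
    and bij_E: "bij_betw (E p) {..<card (\<Gamma> p)} (\<Gamma> p)"
    and shift: "F \<in> K p \<Longrightarrow> F *v s p = M *v r p F + s p"
  using data assms by (auto simp: symmetric_digit_data_def)

lemma bij_E_stab:
  assumes "p < card \<Lambda>"
  shows "bij_betw (\<lambda>(i, F). E p i ** F) ({..<card (\<Gamma> p)} \<times> K p) H"
proof -
  have "bij_betw (map_prod (E p) id) ({..<card (\<Gamma> p)} \<times> K p) (\<Gamma> p \<times> K p)"
    by (intro bij_betw_map_prod bij_E assms bij_betw_id)
  from bij_betw_trans[OF this left_coset_reps_bij_betw[OF left_coset_reps_\<Gamma>[OF assms]]]
  show ?thesis by (simp add: o_def case_prod_unfold)
qed

lemma sum_H:
  assumes "p < card \<Lambda>"
  shows "(\<Sum>A\<in>H. f A) = (\<Sum>i<card (\<Gamma> p). \<Sum>F\<in>K p. f (E p i ** F))"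
  using sum.reindex_bij_betw[OF bij_E_stab[OF assms], of f, symmetric]
  by (simp add: case_prod_unfold sum.cartesian_product)

lemma E_in_H: "p < card \<Lambda> \<Longrightarrow> i < card (\<Gamma> p) \<Longrightarrow> E p i \<in> H"
  using bij_E[of p] left_coset_reps_\<Gamma>[of p] by (auto simp: left_coset_reps_def bij_betw_def)

lemma stab_one: "mat 1 \<in> K p"
  by (simp add: mem_stab H_one)

lemma finite_K: "finite (K p)"
  by (rule finite_subset[OF _ finite_H]) (auto simp: mem_stab)

lemma card_K_pos: "card (K p) > 0"
  using stab_one finite_K card_gt_0_iff by blast

lemma \<Lambda>_orbit:
  assumes "C \<in> lattice_cosets M"
  shows "\<exists>!C'. C' \<in> \<Lambda> \<and> (\<exists>A\<in>H. C' = coset_act A C)"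
proof -
  have "orbit (mat_group H) coset_act C \<in> orbits (mat_group H) (lattice_cosets M) coset_act"
    using assms by (auto simp: orbits_def)
  then have "\<exists>!C'. C' \<in> \<Lambda> \<and> C' \<in> orbit (mat_group H) coset_act C"
    using data by (simp add: symmetric_digit_data_def orbit_transversal_def)
  then show ?thesis by (simp add: orbit_def mat_group_def Bex_def conj_commute)
qed

lemma card_\<Lambda>_pos: "0 < card \<Lambda>"
proof -
  have "\<Lambda> \<noteq> {}" using \<Lambda>_orbit[of "coset 0"] by (auto simp: lattice_cosets_def)
  then show ?thesis using bij_\<Lambda> by (auto simp: bij_betw_def)
qed

lemma digits_bij_betw:
  "bij_betw (\<lambda>(p, i). coset (E p i *v s p)) (SIGMA p:{..<card \<Lambda>}. {..<card (\<Gamma> p)}) (lattice_cosets M)"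
proof (rule bij_betw_imageI)
  have mem_\<Lambda>: "coset (s p) \<in> \<Lambda>" if "p < card \<Lambda>" for p
    using bij_\<Lambda> that by (auto simp: bij_betw_def)
  show "inj_on (\<lambda>(p, i). coset (E p i *v s p)) (SIGMA p:{..<card \<Lambda>}. {..<card (\<Gamma> p)})"
  proof (rule inj_onI, clarsimp)
    fix p i p' i'
    assume p: "p < card \<Lambda>" "i < card (\<Gamma> p)" and p': "p' < card \<Lambda>" "i' < card (\<Gamma> p')"
      and eq: "coset (E p i *v s p) = coset (E p' i' *v s p')"
    have rep: "\<exists>A\<in>H. coset (s q) = coset_act A (coset (E q j *v s q))"
      if q: "q < card \<Lambda>" "j < card (\<Gamma> q)" for q j
    proof -
      obtain B where B: "B \<in> H" "B ** E q j = mat 1" using H_inverse[OF E_in_H[OF q]] .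
      then have "coset_act B (coset (E q j *v s q)) = coset (s q)"
        by (simp add: coset_act_coset matrix_vector_mul_assoc)
      then show ?thesis using B(1) by metis
    qed
    have "coset (E p i *v s p) \<in> lattice_cosets M" by (simp add: lattice_cosets_def)
    then have "coset (s p) = coset (s p')"
      using \<Lambda>_orbit rep[OF p] rep[OF p', folded eq] mem_\<Lambda>[OF p(1)] mem_\<Lambda>[OF p'(1)] by blast
    then have pp: "p = p'"
      using bij_\<Lambda> p(1) p'(1) by (auto simp: bij_betw_def inj_on_def)
    obtain B where B: "B \<in> H" "B ** E p i = mat 1" "E p i ** B = mat 1" using H_inverse[OF E_in_H[OF p]] .
    define F where "F = B ** E p i'"
    have "coset (B *v (E p i' *v s p)) = coset (B *v (E p i *v s p))"
      using coset_cong[OF B(1) eq] pp by simp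
    then have F: "F \<in> K p"
      using B E_in_H[OF p'] pp by (simp add: mem_stab F_def H_mult matrix_vector_mul_assoc)
    have "E p i ** F = E p i' ** mat 1"
      using B(3) by (simp add: F_def matrix_mul_assoc)
    moreover have "(i, F) \<in> {..<card (\<Gamma> p)} \<times> K p" "(i', mat 1) \<in> {..<card (\<Gamma> p)} \<times> K p"
      using F p(2) p'(2) pp stab_one by (simp_all only: mem_Times_iff fst_conv snd_conv lessThan_iff)
    ultimately have "(i, F) = (i', mat 1)"
      using inj_onD[OF bij_betw_imp_inj_on[OF bij_E_stab[OF p(1)]], of "(i, F)" "(i', mat 1)"]
      by (simp only: prod.case)
    then show "p = p' \<and> i = i'" using pp by simp
  qed
  show "(\<lambda>(p, i). coset (E p i *v s p)) ` (SIGMA p:{..<card \<Lambda>}. {..<card (\<Gamma> p)}) = lattice_cosets M"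
  proof (intro equalityI subsetI)
    fix C assume C: "C \<in> lattice_cosets M"
    then obtain x where x: "C = coset x" unfolding lattice_cosets_def by blast
    obtain A where A: "A \<in> H" "coset_act A C \<in> \<Lambda>" using \<Lambda>_orbit[OF C] by blast
    then have "coset (A *v x) \<in> (\<lambda>p. coset (s p)) ` {..<card \<Lambda>}"
      using bij_betw_imp_surj_on[OF bij_\<Lambda>] by (simp add: x coset_act_coset)
    then obtain p where p: "p < card \<Lambda>" "coset (s p) = coset (A *v x)" by fastforce
    obtain B where B: "B \<in> H" "B ** A = mat 1" using H_inverse[OF A(1)] .
    have "B \<in> (\<lambda>(i, F). E p i ** F) ` ({..<card (\<Gamma> p)} \<times> K p)"
      using bij_betw_imp_surj_on[OF bij_E_stab[OF p(1)]] B(1) by simp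
    then obtain i F where i: "i < card (\<Gamma> p)" "F \<in> K p" "B = E p i ** F" by auto
    have "C = coset (B *v s p)"
      using coset_cong[OF B(1) p(2)] B(2) by (simp add: x matrix_vector_mul_assoc)
    also have "\<dots> = coset (E p i *v s p)"
      using coset_cong[OF E_in_H[OF p(1) i(1)], of "F *v s p" "s p"] i
      by (simp add: mem_stab matrix_vector_mul_assoc)
    finally show "C \<in> (\<lambda>(p, i). coset (E p i *v s p)) ` (SIGMA p:{..<card \<Lambda>}. {..<card (\<Gamma> p)})"
      using p(1) i(1) by (intro image_eqI[of _ _ "(p, i)"]) simp_all
  qed (auto simp: lattice_cosets_def)
qed

lemma sum_orbits:
  fixes f :: "(int^'n) set \<Rightarrow> complex"
  shows "(\<Sum>p<card \<Lambda>. (\<Sum>A\<in>H. f (coset (A *v s p))) / of_nat (card (K p))) = (\<Sum>C\<in>lattice_cosets M. f C)"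
proof -
  have "(\<Sum>A\<in>H. f (coset (A *v s p))) / of_nat (card (K p)) = (\<Sum>i<card (\<Gamma> p). f (coset (E p i *v s p)))"
    if p: "p < card \<Lambda>" for p
  proof -
    have "coset ((E p i ** F) *v s p) = coset (E p i *v s p)" if "i < card (\<Gamma> p)" "F \<in> K p" for i F
      using coset_cong[OF E_in_H[OF p that(1)], of "F *v s p" "s p"] that(2)
      by (simp add: mem_stab matrix_vector_mul_assoc)
    then have "(\<Sum>A\<in>H. f (coset (A *v s p))) = (\<Sum>i<card (\<Gamma> p). \<Sum>F\<in>K p. f (coset (E p i *v s p)))"
      unfolding sum_H[OF p] by (intro sum.cong) auto
    then show ?thesis
      using card_K_pos[of p] by (simp flip: sum_distrib_left)
  qed
  then have "(\<Sum>p<card \<Lambda>. (\<Sum>A\<in>H. f (coset (A *v s p))) / of_nat (card (K p)))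
      = (\<Sum>(p, i)\<in>(SIGMA p:{..<card \<Lambda>}. {..<card (\<Gamma> p)}). f (coset (E p i *v s p)))"
    by (simp add: sum.Sigma)
  also have "\<dots> = (\<Sum>C\<in>lattice_cosets M. f C)"
    using sum.reindex_bij_betw[OF digits_bij_betw, of f] by (simp add: case_prod_unfold)
  finally show ?thesis .
qed

lemma coset_ne_zero:
  assumes "p < card \<Lambda>" "A \<in> H"
  shows "coset (A *v s p) = coset 0 \<longleftrightarrow> p = 0"
proof
  assume eq: "coset (A *v s p) = coset 0"
  obtain B where B: "B \<in> H" "B ** A = mat 1" using H_inverse[OF assms(2)] .
  have "coset (s p) = coset (s 0)"
    using coset_cong[OF B(1) eq] B(2) by (simp add: matrix_vector_mul_assoc s_zero)
  then show "p = 0"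
    using bij_\<Lambda> assms(1) card_\<Lambda>_pos by (auto simp: bij_betw_def inj_on_def)
qed (simp add: s_zero)

end

subsection \<open>The symmetric interpolatory mask\<close>

locale symmetric_mask = symmetric_digits M H \<Lambda> s \<Gamma> E r
  for M :: "int^'n^'n" and H :: "(int^'n^'n) set" and \<Lambda> :: "(int^'n) set set"
    and s :: "nat \<Rightarrow> int^'n" and \<Gamma> :: "nat \<Rightarrow> (int^'n^'n) set"
    and E :: "nat \<Rightarrow> nat \<Rightarrow> int^'n^'n" and r :: "nat \<Rightarrow> int^'n^'n \<Rightarrow> int^'n" +
  fixes n :: nat and X :: "nat \<Rightarrow> (int^'n) set" and h :: "nat \<Rightarrow> int^'n \<Rightarrow> real"
  assumes n_pos: "0 < n"
    and finite_X: "finite (X p)"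
    and moments: "\<beta> \<in> Delta n \<Longrightarrow>
      (\<Sum>k\<in>X p. h p k * mpower (rvec k) \<beta>) = mpower (- (matrix_inv (rmat M) *v rvec (s p))) \<beta>"
    and X_zero: "X 0 = {0}"
    and h_zero: "h 0 0 = 1"
begin

abbreviation m :: real where
  "m \<equiv> real_of_int \<bar>det M\<bar>"

abbreviation M_inv :: "real^'n^'n" where
  "M_inv \<equiv> matrix_inv (rmat M)"

definition freq :: "nat \<Rightarrow> int^'n^'n \<Rightarrow> int^'n \<Rightarrow> int^'n" where
  "freq p A k = A *v (M *v k + s p)"

text \<open>
  Since \<^prop>\<open>X 0 = {0}\<close>, the term \<open>p = 0\<close> of the mask is the constant \<open>1 / m\<close>, so that all orbits are
  treated alike.
\<close>

definition coef :: "nat \<Rightarrow> int^'n \<Rightarrow> complex" where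
  "coef p k = of_real (h p k) / (of_real m * of_nat (card (K p)))"

definition mask :: "real^'n \<Rightarrow> complex" where
  "mask \<xi> = (\<Sum>p<card \<Lambda>. \<Sum>A\<in>H. \<Sum>k\<in>X p. coef p k * expi (freq p A k) \<xi>)"

definition G :: "nat \<Rightarrow> real^'n \<Rightarrow> complex" where
  "G p \<xi> = (\<Sum>k\<in>X p. of_real (h p k) / of_real (sqrt m) * expi k \<xi>)"

lemma m_pos: "m > 0"
  using det_nonzero by simp

lemma M_inv_cancel: "M_inv *v (rmat M *v x) = x" "rmat M *v (M_inv *v x) = x"
  using matrix_inv_cancel[OF invertible_rmat[OF det_nonzero]] by simp_all

lemma matrix_inv_transpose_M: "matrix_inv (transpose (rmat M)) = transpose M_inv"
proof -
  have inv: "invertible (transpose (rmat M))"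
    using invertible_rmat[of "transpose M"] det_nonzero by (simp add: rmat_transpose)
  have "rmat M ** M_inv = mat 1" "M_inv ** rmat M = mat 1"
    by (simp_all add: matrix_eq M_inv_cancel flip: matrix_vector_mul_assoc)
  then have "transpose (rmat M) ** transpose M_inv = mat 1"
    by (metis matrix_transpose_mul transpose_mat)
  then have "transpose (rmat M) *v (transpose M_inv *v x) = x" for x
    by (metis matrix_vector_mul_assoc matrix_vector_mul_lid)
  then have "matrix_inv (transpose (rmat M)) *v x = transpose M_inv *v x" for x
    by (metis inv matrix_inv_cancel(1))
  then show ?thesis by (simp add: matrix_eq)
qed

lemma inner_M_inv: "(M_inv *v rvec q) \<bullet> rvec (transpose M *v b) \<in> \<int>"
proof -
  have "(M_inv *v rvec q) \<bullet> rvec (transpose M *v b) = rvec q \<bullet> rvec b"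
    unfolding rvec_mult rmat_transpose
    by (metis M_inv_cancel(2) dot_lmul_matrix inner_commute transpose_matrix_vector)
  then show ?thesis by (simp only: inner_rvec_in_Ints)
qed

lemma freq_in_coset:
  assumes "A \<in> H"
  shows "coset (freq p A k) = coset (A *v s p)"
proof -
  obtain A' where "A ** M = M ** A'" using H_conjugate[OF assms] .
  then have "freq p A k = M *v (A' *v k) + A *v s p"
    by (simp add: freq_def matrix_vector_right_distrib matrix_vector_mul_assoc)
  then show ?thesis unfolding lattice_coset_eq_iff mem_lattice_coset by blast
qed

lemma M_inv_freq:
  assumes "A \<in> H"
  shows "\<exists>A'. \<forall>k. M_inv *v rvec (freq p A k) = rmat A' *v (rvec k - - (M_inv *v rvec (s p))) \<and>
    M_inv *v rvec (freq p A k) = rvec (A' *v k) + M_inv *v rvec (A *v s p)"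
proof -
  obtain A' where A': "A' \<in> H" "A ** M = M ** A'" using H_conjugate[OF assms] .
  have AM: "rmat A *v (rmat M *v x) = rmat M *v (rmat A' *v x)" for x
    by (simp add: matrix_vector_mul_assoc A'(2) flip: rmat_mult)
  have "rmat A *v rvec (s p) = rmat M *v (rmat A' *v (M_inv *v rvec (s p)))"
    by (simp add: M_inv_cancel flip: AM)
  then have s: "M_inv *v rvec (A *v s p) = rmat A' *v (M_inv *v rvec (s p))"
    by (simp only: rvec_mult M_inv_cancel)
  have 2: "M_inv *v rvec (freq p A k) = rvec (A' *v k) + M_inv *v rvec (A *v s p)" for k
    by (simp only: freq_def rvec_mult rvec_add matrix_vector_right_distrib AM M_inv_cancel)
  have 1: "M_inv *v rvec (freq p A k) = rmat A' *v (rvec k - - (M_inv *v rvec (s p)))" for k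
    unfolding 2 s by (simp only: rvec_mult matrix_vector_right_distrib diff_minus_eq_add)
  show ?thesis using 1 2 by blast
qed

lemma mask_Sigma:
  "mask \<xi> = (\<Sum>(p, A, k)\<in>(SIGMA p:{..<card \<Lambda>}. H \<times> X p). coef p k * expi (freq p A k) \<xi>)"
  by (simp add: mask_def sum.Sigma sum.cartesian_product finite_H finite_X)

lemma sum_h: "(\<Sum>k\<in>X p. h p k) = 1"
  using moments[of 0 p] n_pos by (simp add: Delta_def mdeg_def mpower_def)

lemma sum_coef: "(\<Sum>k\<in>X p. coef p k) = 1 / of_real m / of_nat (card (K p))"
proof -
  have "(\<Sum>k\<in>X p. coef p k) = of_real (\<Sum>k\<in>X p. h p k) / (of_real m * of_nat (card (K p)))"
    by (simp add: coef_def sum_divide_distrib)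
  then show ?thesis by (simp add: sum_h)
qed

lemma card_cosets: "of_nat (card (lattice_cosets M)) = complex_of_real m"
proof -
  have "real (card (lattice_cosets M)) = m" by (simp add: card_lattice_cosets[OF det_nonzero])
  then show ?thesis by (metis of_real_of_nat_eq)
qed

lemma mask_refinable: "refinable_mask mask"
proof -
  have "mask 0 = (\<Sum>p<card \<Lambda>. (\<Sum>A\<in>H. 1 / of_real m) / of_nat (card (K p)))"
    by (simp add: mask_def expi_eq_rexpi rexpi_zero_right sum_coef sum_divide_distrib)
  also have "\<dots> = (\<Sum>C\<in>lattice_cosets M. 1 / of_real m)"
    by (rule sum_orbits)
  also have "\<dots> = 1"
    using m_pos card_cosets by simp
  finally have "mask 0 = 1" .
  have eq: "mask = (\<lambda>\<xi>. \<Sum>i\<in>(SIGMA p:{..<card \<Lambda>}. H \<times> X p).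
      (case i of (p, A, k) \<Rightarrow> coef p k) * expi (case i of (p, A, k) \<Rightarrow> freq p A k) \<xi>)"
    unfolding mask_Sigma by (simp add: case_prod_unfold)
  have "trig_poly mask"
    unfolding eq by (rule trig_poly_sum) (simp add: finite_H finite_X)
  with \<open>mask 0 = 1\<close> show ?thesis by (simp add: refinable_mask_def)
qed

lemma mask_symmetric: "symmetric_origin H mask"
  unfolding symmetric_origin_def
proof (intro ballI allI)
  fix B \<xi> assume B: "B \<in> H"
  obtain B' where B': "B' \<in> H" "B' ** B = mat 1" "B ** B' = mat 1" using H_inverse[OF B] .
  have bij: "bij_betw (\<lambda>A. B ** A) H H"
    by (rule bij_betwI[where g = "\<lambda>A. B' ** A"]) (auto simp: H_mult B B' matrix_mul_assoc)
  have "expi (freq p A k) (transpose (rmat B) *v \<xi>) = expi (freq p (B ** A) k) \<xi>" for p A k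
    by (simp only: expi_eq_rexpi freq_def matrix_vector_mul_assoc[symmetric] rvec_mult[of B] rexpi_mult_vec)
  then have "mask (transpose (rmat B) *v \<xi>)
      = (\<Sum>p<card \<Lambda>. \<Sum>A\<in>H. \<Sum>k\<in>X p. coef p k * expi (freq p (B ** A) k) \<xi>)"
    by (simp only: mask_def)
  also have "\<dots> = mask \<xi>"
    unfolding mask_def
    by (intro sum.cong refl sum.reindex_bij_betw[OF bij])
  finally show "mask \<xi> = mask (transpose (rmat B) *v \<xi>)" by simp
qed

lemma K_zero: "K 0 = H"
  by (auto simp: mem_stab s_zero)

lemma mask_term_zero:
  "(\<Sum>A\<in>H. \<Sum>k\<in>X 0. coef 0 k * expi (freq 0 A k) \<xi>) = 1 / of_real m"
proof -
  have "expi (freq 0 A 0) \<xi> = 1" for A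
    by (simp only: freq_def s_zero expi_eq_rexpi matrix_vector_mult_0_right add_0 rvec_zero rexpi_zero)
  then show ?thesis
    using card_K_pos[of 0] by (simp add: X_zero coef_def h_zero K_zero[unfolded s_zero] s_zero)
qed

lemma mask_interpolatory:
  assumes D: "digit_set (transpose M) D"
  shows "interpolatory M D mask"
  unfolding interpolatory_def
proof
  fix \<xi>
  have char: "(\<Sum>t\<in>D. expi (freq p A k) (\<xi> + transpose M_inv *v rvec t))
      = expi (freq p A k) \<xi> * (if p = 0 then of_real m else 0)"
    if p: "p < card \<Lambda>" and A: "A \<in> H" for p A k
  proof -
    let ?q = "freq p A k"
    have "(\<Sum>t\<in>D. expi ?q (\<xi> + transpose M_inv *v rvec t))
        = expi ?q \<xi> * (\<Sum>t\<in>D. rexpi (M_inv *v rvec ?q) (rvec t))"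
      by (simp only: expi_eq_rexpi rexpi_add_right rexpi_mult_vec sum_distrib_left)
    also have "(\<Sum>t\<in>D. rexpi (M_inv *v rvec ?q) (rvec t))
        = (if M_inv *v rvec ?q \<in> range rvec then of_nat (card (lattice_cosets (transpose M))) else 0)"
      by (rule sum_character_digit_set[OF D inner_M_inv])
    also have "of_nat (card (lattice_cosets (transpose M))) = complex_of_real m"
    proof -
      have "real (card (lattice_cosets (transpose M))) = m"
        using card_lattice_cosets[of "transpose M"] det_nonzero by simp
      then show ?thesis by (metis of_real_of_nat_eq)
    qed
    also have "M_inv *v rvec ?q \<in> range rvec \<longleftrightarrow> p = 0"
    proof -
      have "M_inv *v rvec ?q = rvec b \<longleftrightarrow> ?q = M *v b" for b
        by (metis M_inv_cancel rvec_eq_iff rvec_mult)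
      then have "M_inv *v rvec ?q \<in> range rvec \<longleftrightarrow> coset ?q = coset 0"
        unfolding lattice_coset_eq_iff mem_lattice_coset by auto
      then show ?thesis using freq_in_coset[OF A] coset_ne_zero[OF p A] by simp
    qed
    finally show ?thesis .
  qed
  have "(\<Sum>t\<in>D. mask (\<xi> + transpose M_inv *v rvec t))
      = (\<Sum>i\<in>(SIGMA p:{..<card \<Lambda>}. H \<times> X p). \<Sum>t\<in>D. case i of (p, A, k) \<Rightarrow>
          coef p k * expi (freq p A k) (\<xi> + transpose M_inv *v rvec t))"
    unfolding mask_Sigma by (subst sum.swap) (simp add: case_prod_unfold)
  also have "\<dots> = (\<Sum>(p, A, k)\<in>(SIGMA p:{..<card \<Lambda>}. H \<times> X p).
      coef p k * (expi (freq p A k) \<xi> * (if p = 0 then of_real m else 0)))"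
  proof (intro sum.cong refl)
    fix i assume "i \<in> (SIGMA p:{..<card \<Lambda>}. H \<times> X p)"
    then obtain p A k where "i = (p, A, k)" "p < card \<Lambda>" "A \<in> H" by auto
    then show "(\<Sum>t\<in>D. case i of (p, A, k) \<Rightarrow> coef p k * expi (freq p A k) (\<xi> + transpose M_inv *v rvec t))
      = (case i of (p, A, k) \<Rightarrow> coef p k * (expi (freq p A k) \<xi> * (if p = 0 then of_real m else 0)))"
      by (simp only: prod.case char flip: sum_distrib_left)
  qed
  also have "\<dots> = (\<Sum>p<card \<Lambda>. \<Sum>A\<in>H. \<Sum>k\<in>X p. coef p k * (expi (freq p A k) \<xi> * (if p = 0 then of_real m else 0)))"
    by (simp add: sum.Sigma sum.cartesian_product finite_H finite_X)
  also have "\<dots> = (\<Sum>p<card \<Lambda>. if p = 0 then of_real m * (\<Sum>A\<in>H. \<Sum>k\<in>X 0. coef 0 k * expi (freq 0 A k) \<xi>) else 0)"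
    by (intro sum.cong refl) (auto simp: sum_distrib_left mult_ac)
  also have "\<dots> = of_real m * (1 / of_real m)"
    using card_\<Lambda>_pos by (simp add: mask_term_zero)
  also have "\<dots> = 1" using m_pos by simp
  finally show "(\<Sum>t\<in>D. mask (\<xi> + matrix_inv (transpose (rmat M)) *v rvec t)) = 1"
    by (simp only: matrix_inv_transpose_M)
qed

lemma mask_sum_rule:
  assumes D: "digit_set (transpose M) D"
  shows "sum_rule M D n mask"
  unfolding sum_rule_def
proof (intro ballI)
  fix t and \<beta> :: "nat^'n" assume t: "t \<in> D - {0}" and \<beta>: "\<beta> \<in> Delta n"
  let ?w = "(2 * complex_of_real pi * \<i>) ^ mdeg \<beta>"
  define z where "z = transpose M_inv *v rvec t"
  define rep where "rep C = (SOME x. x \<in> C)" for C :: "(int^'n) set"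
  have rep: "rep C \<in> C" if "C \<in> lattice_cosets M" for C
  proof -
    have "\<exists>x. x \<in> C" using that mem_lattice_coset_self by (auto simp: lattice_cosets_def)
    then show ?thesis unfolding rep_def by (rule someI_ex)
  qed
  have z_inner: "z \<bullet> x = rvec t \<bullet> (M_inv *v x)" for x
    unfolding z_def by (metis dot_lmul_matrix transpose_matrix_vector)
  have z_int: "z \<bullet> rvec (M *v b) \<in> \<int>" for b
    by (simp only: z_inner rvec_mult M_inv_cancel inner_rvec_in_Ints)
  have "z \<notin> range rvec"
  proof
    assume "z \<in> range rvec"
    then obtain k where k: "z = rvec k" by blast
    have "rvec t = transpose (rmat M) *v z"
      unfolding z_def by (metis M_inv_cancel(1) matrix_vector_mul_assoc matrix_vector_mul_lid
          matrix_eq matrix_transpose_mul transpose_mat)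
    then have "t = transpose M *v k"
      by (simp only: k rvec_eq_iff flip: rmat_transpose rvec_mult)
    then have "t \<in> lattice_coset (transpose M) 0" by (auto simp: mem_lattice_coset)
    then have "lattice_coset (transpose M) t = lattice_coset (transpose M) 0"
      by (simp only: lattice_coset_eq_iff)
    then have "t = 0"
      using inj_onD[OF bij_betw_imp_inj_on[OF digit_set_bij_betw[OF D]]] D t
      by (auto simp: digit_set_def)
    then show False using t by simp
  qed
  from sum_character_lattice_cosets[OF z_int this rep]
  have zero: "(\<Sum>C\<in>lattice_cosets M. rexpi z (rvec (rep C))) = 0" .
  have inner_sum: "(\<Sum>k\<in>X p. coef p k * of_real (mpower (M_inv *v rvec (freq p A k)) \<beta>) * rexpi (M_inv *v rvec (freq p A k)) (rvec t))
      = of_bool (\<beta> = 0) / of_real m * (rexpi z (rvec (rep (coset (A *v s p)))) / of_nat (card (K p)))"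
    if A: "A \<in> H" for p A
  proof -
    obtain A' where A': "\<And>k. M_inv *v rvec (freq p A k) = rmat A' *v (rvec k - - (M_inv *v rvec (s p)))"
      "\<And>k. M_inv *v rvec (freq p A k) = rvec (A' *v k) + M_inv *v rvec (A *v s p)"
      using M_inv_freq[OF A, of p] by blast
    have "rexpi (rvec (A' *v k)) (rvec t) = 1" for k
      by (simp only: rexpi_eq_1_iff inner_rvec_in_Ints)
    then have "rexpi (M_inv *v rvec (freq p A k)) (rvec t) = rexpi (M_inv *v rvec (A *v s p)) (rvec t)" for k
      by (simp only: A'(2) rexpi_add mult_1_left)
    moreover have "rexpi (M_inv *v rvec (A *v s p)) (rvec t) = rexpi z (rvec (A *v s p))"
      by (simp only: rexpi_def z_inner inner_commute)
    moreover have "rexpi z (rvec (rep (coset (A *v s p)))) = rexpi z (rvec (A *v s p))"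
      by (intro character_lattice_coset_cong[OF z_int] rep) (simp add: lattice_cosets_def)
    ultimately have eq: "rexpi (M_inv *v rvec (freq p A k)) (rvec t) = rexpi z (rvec (rep (coset (A *v s p))))" for k
      by simp
    have "(\<Sum>k\<in>X p. coef p k * of_real (mpower (M_inv *v rvec (freq p A k)) \<beta>) * rexpi (M_inv *v rvec (freq p A k)) (rvec t))
      = of_real (\<Sum>k\<in>X p. h p k * mpower (M_inv *v rvec (freq p A k)) \<beta>) / (of_real m * of_nat (card (K p)))
          * rexpi z (rvec (rep (coset (A *v s p))))"
      unfolding eq coef_def by (simp add: sum_distrib_right sum_divide_distrib)
    also have "(\<Sum>k\<in>X p. h p k * mpower (M_inv *v rvec (freq p A k)) \<beta>) = of_bool (\<beta> = 0)"
      unfolding A'(1) by (rule moments_linear_image[OF moments \<beta>])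
    finally show ?thesis by simp
  qed
  have "mask (transpose M_inv *v \<xi>) = (\<Sum>i\<in>(SIGMA p:{..<card \<Lambda>}. H \<times> X p).
      (case i of (p, A, k) \<Rightarrow> coef p k) * rexpi (case i of (p, A, k) \<Rightarrow> M_inv *v rvec (freq p A k)) \<xi>)" for \<xi>
    unfolding mask_Sigma expi_eq_rexpi by (simp add: case_prod_unfold rexpi_mult_vec)
  then have "mderiv \<beta> (\<lambda>\<xi>. mask (transpose M_inv *v \<xi>)) (rvec t)
      = ?w * (\<Sum>i\<in>(SIGMA p:{..<card \<Lambda>}. H \<times> X p).
          (case i of (p, A, k) \<Rightarrow> coef p k)
          * of_real (mpower (case i of (p, A, k) \<Rightarrow> M_inv *v rvec (freq p A k)) \<beta>)
          * rexpi (case i of (p, A, k) \<Rightarrow> M_inv *v rvec (freq p A k)) (rvec t))"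
    by (simp only: mderiv_exp_sum)
  also have "\<dots> = ?w * (\<Sum>p<card \<Lambda>. \<Sum>A\<in>H. \<Sum>k\<in>X p. coef p k * of_real (mpower (M_inv *v rvec (freq p A k)) \<beta>) * rexpi (M_inv *v rvec (freq p A k)) (rvec t))"
    by (simp add: sum.Sigma sum.cartesian_product finite_H finite_X case_prod_unfold)
  also have "\<dots> = ?w * (of_bool (\<beta> = 0) / of_real m
      * (\<Sum>p<card \<Lambda>. (\<Sum>A\<in>H. rexpi z (rvec (rep (coset (A *v s p))))) / of_nat (card (K p))))"
    by (simp only: inner_sum sum_distrib_left sum_divide_distrib cong: sum.cong)
  also have "\<dots> = 0"
    by (simp only: sum_orbits[of "\<lambda>C. rexpi z (rvec (rep C))"] zero mult_zero_right)
  finally show "mderiv \<beta> (\<lambda>\<xi>. mask (matrix_inv (transpose (rmat M)) *v \<xi>)) (rvec t) = 0"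
    by (simp only: matrix_inv_transpose_M)
qed

lemma G_trig_poly: "trig_poly (G p)"
  unfolding G_def[abs_def] by (rule trig_poly_sum[OF finite_X])

lemma mderiv_G:
  assumes "\<beta> \<in> Delta n"
  shows "mderiv \<beta> (G p) 0 = (2 * of_real pi * \<i>) ^ mdeg \<beta> / of_real (sqrt m)
    * of_real (mpower (- (M_inv *v rvec (s p))) \<beta>)"
proof -
  have "mderiv \<beta> (G p) 0 = (2 * of_real pi * \<i>) ^ mdeg \<beta>
      * (\<Sum>k\<in>X p. of_real (h p k) / of_real (sqrt m) * of_real (mpower (rvec k) \<beta>) * rexpi (rvec k) 0)"
    unfolding G_def[abs_def] expi_eq_rexpi by (rule mderiv_exp_sum)
  also have "(\<Sum>k\<in>X p. of_real (h p k) / of_real (sqrt m) * of_real (mpower (rvec k) \<beta>) * rexpi (rvec k) 0)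
      = complex_of_real (\<Sum>k\<in>X p. h p k * mpower (rvec k) \<beta>) / of_real (sqrt m)"
    by (simp only: rexpi_zero_right of_real_sum of_real_mult sum_divide_distrib) (simp add: mult_ac)
  finally show ?thesis by (simp only: moments[OF assms] times_divide_eq_left times_divide_eq_right)
qed

lemma nu_eq:
  assumes p: "p < card \<Lambda>"
  shows "1 / of_real (sqrt m) * nu M H s \<Gamma> E r G p \<xi> = (\<Sum>A\<in>H. \<Sum>k\<in>X p. coef p k * expi (freq p A k) \<xi>)"
proof -
  have expi: "expi (E p i *v s p) \<xi> * (expi k ((transpose (rmat M) ** transpose (rmat F) ** transpose (rmat (E p i))) *v \<xi>)
      * expi (r p F) ((transpose (rmat M) ** transpose (rmat (E p i))) *v \<xi>)) = expi (freq p (E p i ** F) k) \<xi>"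
    if F: "F \<in> K p" for i F k
  proof -
    have "freq p (E p i ** F) k = E p i *v s p + ((E p i ** F ** M) *v k + (E p i ** M) *v r p F)"
      using shift[OF p F]
      by (simp add: freq_def matrix_vector_right_distrib add_ac flip: matrix_vector_mul_assoc)
    then show ?thesis
      by (simp only: expi_eq_rexpi rvec_add rexpi_add rvec_mult rmat_mult rexpi_mult_vec
          matrix_transpose_mul matrix_mul_assoc)
  qed
  have sqrt: "complex_of_real (sqrt m) * of_real (sqrt m) = of_real m"
    using m_pos by (simp flip: of_real_mult)
  have "1 / of_real (sqrt m) * nu M H s \<Gamma> E r G p \<xi>
      = (\<Sum>i<card (\<Gamma> p). \<Sum>F\<in>K p. \<Sum>k\<in>X p. coef p k * expi (freq p (E p i ** F) k) \<xi>)"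
    unfolding nu_def G_def sum_distrib_left sum_distrib_right
  proof (intro sum.cong refl)
    fix i F k assume F: "F \<in> K p"
    show "1 / of_real (sqrt m) * (expi (E p i *v s p) \<xi> / of_nat (card (K p)) *
        (of_real (h p k) / of_real (sqrt m) * expi k ((transpose (rmat M) ** transpose (rmat F) ** transpose (rmat (E p i))) *v \<xi>)
        * expi (r p F) ((transpose (rmat M) ** transpose (rmat (E p i))) *v \<xi>))) = coef p k * expi (freq p (E p i ** F) k) \<xi>"
      unfolding expi[OF F, symmetric] coef_def sqrt[symmetric] by (simp add: mult_ac)
  qed
  then show ?thesis by (simp only: sum_H[OF p])
qed

lemma mask_eq_nu:
  "mask \<xi> = 1 / of_real m + 1 / of_real (sqrt m) * (\<Sum>p\<in>{1..<card \<Lambda>}. nu M H s \<Gamma> E r G p \<xi>)"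
proof -
  have "mask \<xi> = (\<Sum>p\<in>{0..<card \<Lambda>}. \<Sum>A\<in>H. \<Sum>k\<in>X p. coef p k * expi (freq p A k) \<xi>)"
    by (simp only: mask_def lessThan_atLeast0)
  also have "\<dots> = 1 / of_real m + (\<Sum>p\<in>{1..<card \<Lambda>}. \<Sum>A\<in>H. \<Sum>k\<in>X p. coef p k * expi (freq p A k) \<xi>)"
    by (simp only: sum.atLeast_Suc_lessThan[OF card_\<Lambda>_pos] mask_term_zero One_nat_def)
  also have "(\<Sum>p\<in>{1..<card \<Lambda>}. \<Sum>A\<in>H. \<Sum>k\<in>X p. coef p k * expi (freq p A k) \<xi>)
      = (\<Sum>p\<in>{1..<card \<Lambda>}. 1 / of_real (sqrt m) * nu M H s \<Gamma> E r G p \<xi>)"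
    by (intro sum.cong refl) (simp only: nu_eq atLeastLessThan_iff)
  finally show ?thesis by (simp only: sum_distrib_left)
qed

end

theorem theorem11:
  fixes M :: "int ^ 'd ^ 'd"
    and H :: "(int ^ 'd ^ 'd) set"
    and n :: nat
    and m :: real
    and Dstar :: "(int ^ 'd) set"
    and \<Lambda> :: "(int ^ 'd) set set"
    and s :: "nat \<Rightarrow> int ^ 'd"
    and \<Gamma> :: "nat \<Rightarrow> (int ^ 'd ^ 'd) set"
    and E :: "nat \<Rightarrow> nat \<Rightarrow> int ^ 'd ^ 'd"
    and r :: "nat \<Rightarrow> int ^ 'd ^ 'd \<Rightarrow> int ^ 'd"
  assumes "dilation_matrix M"
    and "m = real_of_int \<bar>det M\<bar>"
    and "symmetry_group_wrt M H"
    and "digit_set (transpose M) Dstar"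
    and "symmetric_digit_data M H \<Lambda> s \<Gamma> E r"
  shows "\<exists>m\<^sub>0. refinable_mask m\<^sub>0 \<and> interpolatory M Dstar m\<^sub>0 \<and>
    symmetric_origin H m\<^sub>0 \<and> sum_rule M Dstar n m\<^sub>0 \<and>
    (\<exists>G. (\<forall>p\<in>{1..<card \<Lambda>}. trig_poly (G p) \<and>
            (\<forall>\<beta>\<in>Delta n. mderiv \<beta> (G p) 0 =
               (2 * of_real pi * \<i>) ^ mdeg \<beta> / of_real (sqrt m) *
               of_real (mpower (- (matrix_inv (rmat M) *v rvec (s p))) \<beta>))) \<and>
         (\<forall>\<xi>. m\<^sub>0 \<xi> = 1 / of_real m +
            1 / of_real (sqrt m) * (\<Sum>p\<in>{1..<card \<Lambda>}. nu M H s \<Gamma> E r G p \<xi>)))"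
proof -
  interpret symmetric_digits M H \<Lambda> s \<Gamma> E r
    using assms by unfold_locales (simp_all add: dilation_matrix_det_nonzero)
  let ?a = "\<lambda>p. - (matrix_inv (rmat M) *v rvec (s p))"
  \<comment> \<open>\<^term>\<open>Suc n\<close> because for \<^prop>\<open>n = 0\<close> the moments would not force \<open>m\<^sub>0(0) = 1\<close>.\<close>
  let ?P = "\<lambda>p X h. finite X \<and> (\<forall>\<beta>\<in>Delta (Suc n). (\<Sum>k\<in>X. h k * mpower (rvec k) \<beta>) = mpower (?a p) \<beta>) \<and>
    (?a p = 0 \<longrightarrow> X = {0} \<and> h 0 = (1::real))"
  have "\<forall>p. \<exists>X h. ?P p X h" using moment_weights by blast
  from choice[OF this] obtain X where "\<forall>p. \<exists>h. ?P p (X p) h" by blast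
  from choice[OF this] obtain h where Xh: "\<And>p. ?P p (X p) (h p)" by blast
  have a0: "?a 0 = 0"
    by (simp only: s_zero rvec_zero matrix_vector_mult_0_right neg_equal_zero minus_zero)
  interpret symmetric_mask M H \<Lambda> s \<Gamma> E r "Suc n" X h
  proof
    show "X 0 = {0}" "h 0 0 = 1" using Xh[of 0] a0 by blast+
  qed (use Xh in auto)
  have Delta: "Delta n \<subseteq> (Delta (Suc n) :: (nat^'d) set)" by (auto simp: Delta_def)
  have m: "m = real_of_int \<bar>det M\<bar>" by fact
  show ?thesis
    unfolding m
  proof (intro exI[of _ mask] exI[of _ G] conjI ballI allI)
    show "sum_rule M Dstar n mask"
      using mask_sum_rule[OF assms(4)] Delta unfolding sum_rule_def by blast
  qed (use Delta in \<open>blast intro: mask_refinable mask_interpolatory[OF assms(4)] mask_symmetric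
      G_trig_poly mderiv_G mask_eq_nu\<close>)+
qed

end
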